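(* There is an absolute constant $C>0$ such that the following holds. In the setting described in the context (convex case $\mu=0$), let $M\ge 0$ and $\alpha>0$ be real numbers and run projected SGD with clipping with $$M_t=\max\{2G,\;M t^{1/p}\},\qquad \eta_t=\min\Big\{\frac{\alpha}{G\sqrt t},\;\frac{\alpha}{M_t}\Big\}\qquad(t\ge 1).$$ For every integer $T\ge1$, with $\bar x_T=\frac1T\sum_{t=1}^T x_t$, $$\mathbb E\left[F(\bar x_T)-F(x_* )\right]\le C\left(\alpha\big(\log(eT)+(\sigma/M)^{2p}\log^2(eT)\big)+\frac{\|x_1-x_*\|^2}{\alpha}\right)\max\left\{\frac{G}{\sqrt T},\;\frac{M}{T^{\frac{p-1}{p}}}\right\}.$$ In particular, with the choice $M=\sigma$, $$\mathbb E\left[F(\bar x_T)-F(x_* )\right]\le C\left(\alpha\log^2(eT)+\frac{\|x_1-x_*\|^2}{\alpha}\right)\max\left\{\frac{G}{\sqrt T},\;\frac{\sigma}{T^{\frac{p-1}{p}}}\right\}.$$ The constant $C$ does not depend on $F,\mathcal X,d$, the oracle, $p,G,\sigma,M,\alpha,T,x_1,x_*$.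
   Context: $\|\cdot\|$ is the Euclidean norm on $\mathbb R^d$ and $\log$ is the natural logarithm. Problem. $F$ is a convex function on $\mathbb R^d$ (possibly $+\infty$-valued), $\mathcal X\subseteq \mathrm{int}(\mathrm{dom}(F))\subseteq\mathbb R^d$ is a closed convex set (not assumed bounded), and $\partial F(x)$ is the set of subgradients of $F$ at $x$. Assumptions: (1) there is $x_*\in\arg\min_{x\in\mathcal X}F(x)$ with $F(x_* )>-\infty$; (2) $\mu$-strong convexity with $\mu=0$: $F(x)\ge F(y)+\langle g,x-y\rangle$ for all $x,y\in\mathcal X$, $g\in\partial F(y)$; (3) there is $G>0$ with $\|g\|\le G$ for all $x\in\mathcal X$, $g\in\partial F(x)$; (4) for every $x\in\mathcal X$ one can access a history-independent random vector $\widehat\partial F(x)$ with $\mathbb E[\widehat\partial F(x)\mid x]\in\partial F(x)$; (5) there are $p\in(1,2]$ and $\sigma\ge0$ with $\mathbb E[\|\widehat\partial F(x)-\mathbb E[\widehat\partial F(x)\mid x]\|^p\mid x]\le\sigma^p$. Consequently, with $\mathcal F_t=\sigma(\widehat\partial F(x_1),\dots,\widehat\partial F(x_t))$, the conditional versions of (4), (5) given $\mathcal F_{t-1}$ hold at the iterate $x_t$. Algorithm (projected SGD with clipping). Input $x_1\in\mathcal X$ (deterministic), $M_t>0$, $\eta_t>0$. For $t=1,2,\dots$: $g_t=\min\{1,\,M_t/\|\widehat\partial F(x_t)\|\}\,\widehat\partial F(x_t)$ and $x_{t+1}=\Pi_{\mathcal X}(x_t-\eta_t g_t)$, where $\Pi_{\mathcal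 X}$ is Euclidean projection onto $\mathcal X$ (and $g_t=0$ if $\widehat\partial F(x_t)=0$). Convention: if $M=\sigma=0$, $\sigma/M$ is read as $0$; if $M=0<\sigma$, a bound containing $\sigma/M$ is read as $+\infty$ (vacuous). *)

theory Defs
  imports "HOL-Probability.Probability"
begin

text \<open>
  The constant of the theorem must not depend on the dimension, so the dimension has to be a term
  rather than a type. The space of dimension \<open>d\<close> is therefore the library's \<^const>\<open>Euclidean_space\<close>:
  the carrier consists of the functions \<^typ>\<open>nat \<Rightarrow> real\<close> that vanish at all indices \<open>i \<ge> d\<close>,
  with the topology of coordinatewise convergence. The metric that the library puts on
  \<^typ>\<open>nat \<Rightarrow> real\<close> is not the Euclidean one, hence the norm is given explicitly.
\<close>

abbreviation Rd :: "nat \<Rightarrow> (nat \<Rightarrow> real) set" where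
  "Rd d \<equiv> topspace (Euclidean_space d)"

abbreviation Rd_borel :: "nat \<Rightarrow> (nat \<Rightarrow> real) measure" where
  "Rd_borel d \<equiv> restrict_space borel (Rd d)"

definition enorm :: "nat \<Rightarrow> (nat \<Rightarrow> real) \<Rightarrow> real" where
  "enorm d x = L2_set x {..<d}"

definition einner :: "nat \<Rightarrow> (nat \<Rightarrow> real) \<Rightarrow> (nat \<Rightarrow> real) \<Rightarrow> real" where
  "einner d x y = (\<Sum>i<d. x i * y i)"

definition vdiff :: "(nat \<Rightarrow> real) \<Rightarrow> (nat \<Rightarrow> real) \<Rightarrow> nat \<Rightarrow> real" where
  "vdiff x y = (\<lambda>i. x i - y i)"

definition vscale :: "real \<Rightarrow> (nat \<Rightarrow> real) \<Rightarrow> nat \<Rightarrow> real" where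
  "vscale c x = (\<lambda>i. c * x i)"

definition segment_point :: "real \<Rightarrow> (nat \<Rightarrow> real) \<Rightarrow> (nat \<Rightarrow> real) \<Rightarrow> nat \<Rightarrow> real" where
  "segment_point u x y = (\<lambda>i. (1 - u) * x i + u * y i)"

definition convex_set :: "(nat \<Rightarrow> real) set \<Rightarrow> bool" where
  "convex_set X \<longleftrightarrow> (\<forall>x\<in>X. \<forall>y\<in>X. \<forall>u. 0 \<le> u \<and> u \<le> 1 \<longrightarrow> segment_point u x y \<in> X)"

definition convex_fun :: "nat \<Rightarrow> ((nat \<Rightarrow> real) \<Rightarrow> ereal) \<Rightarrow> bool" where
  "convex_fun d F \<longleftrightarrow>
     (\<forall>x\<in>Rd d. F x \<noteq> -\<infinity>) \<and>
     (\<forall>x\<in>Rd d. \<forall>y\<in>Rd d. \<forall>u. 0 < u \<and> u < 1 \<longrightarrow>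
        F (segment_point u x y) \<le> ereal (1 - u) * F x + ereal u * F y)"

definition eff_dom :: "nat \<Rightarrow> ((nat \<Rightarrow> real) \<Rightarrow> ereal) \<Rightarrow> (nat \<Rightarrow> real) set" where
  "eff_dom d F = {x \<in> Rd d. F x < \<infinity>}"

definition subgradients ::
  "nat \<Rightarrow> ((nat \<Rightarrow> real) \<Rightarrow> ereal) \<Rightarrow> (nat \<Rightarrow> real) \<Rightarrow> (nat \<Rightarrow> real) set" where
  "subgradients d F x = {g \<in> Rd d. \<forall>y\<in>Rd d. F y \<ge> F x + ereal (einner d g (vdiff y x))}"

definition proj ::
  "nat \<Rightarrow> (nat \<Rightarrow> real) set \<Rightarrow> (nat \<Rightarrow> real) \<Rightarrow> nat \<Rightarrow> real" where
  "proj d X y = arg_min_on (\<lambda>z. enorm d (vdiff y z)) X"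

definition mean_vec :: "(nat \<Rightarrow> real) measure \<Rightarrow> nat \<Rightarrow> real" where
  "mean_vec N = (\<lambda>i. \<integral>v. v i \<partial>N)"

text \<open>
  The oracle is history-independent: its answer to the query \<open>x\<close> is a random vector whose law
  \<open>Q x\<close> depends on \<open>x\<close> only, so a conditional expectation given \<open>x\<close> is an integral against \<open>Q x\<close>.
  That \<open>Q\<close> is a Markov kernel is what makes the iterates, and hence all expectations, well defined.
  The moment bound is a nonnegative integral, so that it includes the existence of the moment.
\<close>

locale sgd_setting =
  fixes d :: nat
    and F :: "(nat \<Rightarrow> real) \<Rightarrow> ereal"
    and X :: "(nat \<Rightarrow> real) set"
    and x_star :: "nat \<Rightarrow> real"
    and G p \<sigma> :: real
    and Q :: "(nat \<Rightarrow> real) \<Rightarrow> (nat \<Rightarrow> real) measure"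
  assumes F_convex: "convex_fun d F"
    and X_interior: "X \<subseteq> Euclidean_space d interior_of eff_dom d F"
    and X_closed: "closedin (Euclidean_space d) X"
    and X_convex: "convex_set X"
    and x_star_min: "is_arg_min F (\<lambda>x. x \<in> X) x_star"
    and F_x_star: "F x_star > -\<infinity>"
    and convexity: "\<And>x y g. x \<in> X \<Longrightarrow> y \<in> X \<Longrightarrow> g \<in> subgradients d F y \<Longrightarrow>
                      F x \<ge> F y + ereal (einner d g (vdiff x y))"
    and G_pos: "G > 0"
    and subgradient_bound: "\<And>x g. x \<in> X \<Longrightarrow> g \<in> subgradients d F x \<Longrightarrow> enorm d g \<le> G"
    and oracle_kernel: "Q \<in> restrict_space borel X \<rightarrow>\<^sub>M prob_algebra (Rd_borel d)"
    and oracle_integrable: "\<And>x i. x \<in> X \<Longrightarrow> integrable (Q x) (\<lambda>v. v i)"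
    and oracle_unbiased: "\<And>x. x \<in> X \<Longrightarrow> mean_vec (Q x) \<in> subgradients d F x"
    and p_range: "1 < p" "p \<le> 2"
    and \<sigma>_nonneg: "\<sigma> \<ge> 0"
    and oracle_moment: "\<And>x. x \<in> X \<Longrightarrow>
          (\<integral>\<^sup>+v. ennreal (enorm d (vdiff v (mean_vec (Q x))) powr p) \<partial>Q x) \<le> ennreal (\<sigma> powr p)"

text \<open>For \<open>v = 0\<close> the quotient \<open>m / 0\<close> is \<open>0\<close> and the clipped vector is \<open>0\<close>, as it should be.\<close>

definition clip :: "nat \<Rightarrow> real \<Rightarrow> (nat \<Rightarrow> real) \<Rightarrow> nat \<Rightarrow> real" where
  "clip d m v = vscale (min 1 (m / enorm d v)) v"

definition clip_level :: "real \<Rightarrow> real \<Rightarrow> real \<Rightarrow> nat \<Rightarrow> real" where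
  "clip_level G p M t = max (2 * G) (M * real t powr (1 / p))"

definition step_size :: "real \<Rightarrow> real \<Rightarrow> real \<Rightarrow> real \<Rightarrow> nat \<Rightarrow> real" where
  "step_size G p M \<alpha> t = min (\<alpha> / (G * sqrt (real t))) (\<alpha> / clip_level G p M t)"

text \<open>
  Shift of indices: \<open>sgd_iterate \<dots> \<xi> n\<close> is the iterate at time \<open>n + 1\<close>, and \<open>\<xi> n\<close> is the oracle's
  answer at that iterate, so \<open>sgd_iterate \<dots> \<xi> n\<close> depends only on \<open>\<xi> 0, \<dots>, \<xi> (n - 1)\<close>.
\<close>

primrec sgd_iterate ::
  "nat \<Rightarrow> (nat \<Rightarrow> real) set \<Rightarrow> (nat \<Rightarrow> real) \<Rightarrow> (nat \<Rightarrow> real) \<Rightarrow> (nat \<Rightarrow> real) \<Rightarrow>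
     (nat \<Rightarrow> nat \<Rightarrow> real) \<Rightarrow> nat \<Rightarrow> nat \<Rightarrow> real" where
  "sgd_iterate d X Mt \<eta> x1 \<xi> 0 = x1"
| "sgd_iterate d X Mt \<eta> x1 \<xi> (Suc n) =
     proj d X (vdiff (sgd_iterate d X Mt \<eta> x1 \<xi> n)
                     (vscale (\<eta> (Suc n)) (clip d (Mt (Suc n)) (\<xi> n))))"

definition sgd_average ::
  "nat \<Rightarrow> (nat \<Rightarrow> real) set \<Rightarrow> (nat \<Rightarrow> real) \<Rightarrow> (nat \<Rightarrow> real) \<Rightarrow> (nat \<Rightarrow> real) \<Rightarrow>
     nat \<Rightarrow> (nat \<Rightarrow> nat \<Rightarrow> real) \<Rightarrow> nat \<Rightarrow> real" where
  "sgd_average d X Mt \<eta> x1 T \<xi> =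
     (\<lambda>i. (\<Sum>t=1..T. sgd_iterate d X Mt \<eta> x1 \<xi> (t - 1) i) / real T)"

text \<open>
  The run lives on the canonical sample space of sequences \<open>\<xi>\<close> of oracle answers. Its law is the
  Ionescu-Tulcea measure: given \<open>\<xi> 0, \<dots>, \<xi> (n - 1)\<close>, the answer \<open>\<xi> n\<close> has law \<open>Q\<close> at the current
  iterate. The law of the iterates is the same on every probability space that carries a run.
\<close>

definition sgd_law ::
  "nat \<Rightarrow> (nat \<Rightarrow> real) set \<Rightarrow> ((nat \<Rightarrow> real) \<Rightarrow> (nat \<Rightarrow> real) measure) \<Rightarrow>
     (nat \<Rightarrow> real) \<Rightarrow> (nat \<Rightarrow> real) \<Rightarrow> (nat \<Rightarrow> real) \<Rightarrow> (nat \<Rightarrow> nat \<Rightarrow> real) measure" where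
  "sgd_law d X Q Mt \<eta> x1 =
     projective_family.lim UNIV
       (Ionescu_Tulcea.CI (\<lambda>n \<xi>. Q (sgd_iterate d X Mt \<eta> x1 \<xi> n)) (\<lambda>_. Rd_borel d))
       (\<lambda>_. Rd_borel d)"

text \<open>
  The average lies in the convex set \<open>X\<close>, where \<open>F\<close> is finite, so the conversion from
  \<^typ>\<open>ereal\<close> loses nothing. A bound on an expectation includes integrability, since the
  integral of a function that is not integrable is \<open>0\<close> by convention.
\<close>

definition expected_gap_le ::
  "nat \<Rightarrow> ((nat \<Rightarrow> real) \<Rightarrow> ereal) \<Rightarrow> (nat \<Rightarrow> real) set \<Rightarrow> (nat \<Rightarrow> real) \<Rightarrow>
     ((nat \<Rightarrow> real) \<Rightarrow> (nat \<Rightarrow> real) measure) \<Rightarrow> (nat \<Rightarrow> real) \<Rightarrow> (nat \<Rightarrow> real) \<Rightarrow>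
     (nat \<Rightarrow> real) \<Rightarrow> nat \<Rightarrow> real \<Rightarrow> bool" where
  "expected_gap_le d F X x_star Q Mt \<eta> x1 T B \<longleftrightarrow>
     (let P = sgd_law d X Q Mt \<eta> x1;
          gap = (\<lambda>\<xi>. real_of_ereal (F (sgd_average d X Mt \<eta> x1 T \<xi>) - F x_star))
      in integrable P gap \<and> (\<integral>\<xi>. gap \<xi> \<partial>P) \<le> B)"

end

theory Submission
  imports Defs
begin

text \<open>
  Let \<open>m\<close> be the mean of the oracle answer \<open>v\<close> at the iterate \<open>x\<close>, \<open>K\<close> the clipping level and
  \<open>u = \<parallel>v - m\<parallel>\<close>. Clipping moves \<open>v\<close> only if \<open>\<parallel>v\<parallel> > K\<close>, and then \<open>u \<ge> K / 2\<close> because \<open>\<parallel>m\<parallel> \<le> G \<le> K / 2\<close>.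
  Hence the clipping error is at most \<open>2 u\<^sup>p K\<^sup>1\<^sup>-\<^sup>p\<close>, and the squared clipped vector is at most
  \<open>2 G\<^sup>2 + 2 u\<^sup>p K\<^sup>2\<^sup>-\<^sup>p\<close>, pointwise. With \<open>D\<^sub>t\<close> the distance of \<open>x\<^sub>t\<close> to \<open>x\<^sub>*\<close> and \<open>r = (\<sigma> / M)\<^sup>p\<close>,
  the choice of \<open>K\<close> and \<open>\<eta>\<close> turns this into
  \<open>E D\<^sub>t\<^sub>+\<^sub>1\<^sup>2 + 2 \<eta>\<^sub>t E (F x\<^sub>t - F x\<^sub>*) \<le> E D\<^sub>t\<^sup>2 + (4 \<alpha> r / t) (E D\<^sub>t\<^sup>2)\<^sup>1\<^sup>/\<^sup>2 + 2 \<alpha>\<^sup>2 (1 + r) / t\<close>.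
  Summation gives a quadratic inequality for the largest \<open>E D\<^sub>t\<^sup>2\<close>, which bounds the sum of the gaps;
  Jensen's inequality concludes. Each \<open>D\<^sub>t\<close> is bounded by a deterministic constant because
  \<open>\<eta> K \<le> \<alpha>\<close>, and \<open>F\<close> is \<open>G\<close>-Lipschitz on \<open>X\<close>, so integrability is never an issue.
\<close>

section \<open>Euclidean geometry on \<open>nat \<Rightarrow> real\<close>\<close>

lemma enorm_nonneg [simp]: "0 \<le> enorm d x"
  by (simp add: enorm_def)

lemma enorm_power2: "(enorm d x)\<^sup>2 = einner d x x"
  by (simp add: enorm_def einner_def L2_set_def power2_eq_square sum_nonneg)

lemma einner_commute: "einner d x y = einner d y x"
  by (simp add: einner_def mult.commute)

lemma einner_vdiff_left: "einner d (vdiff x y) z = einner d x z - einner d y z"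
  by (simp add: einner_def vdiff_def algebra_simps sum_subtractf)

lemma einner_vdiff_right: "einner d z (vdiff x y) = einner d z x - einner d z y"
  by (simp add: einner_def vdiff_def algebra_simps sum_subtractf)

lemma einner_vscale_left: "einner d (vscale c x) y = c * einner d x y"
  by (simp add: einner_def vscale_def sum_distrib_left mult.assoc)

lemma einner_vscale_right: "einner d y (vscale c x) = c * einner d y x"
  by (simp add: einner_commute[of d y] einner_vscale_left)

lemmas einner_simps =
  einner_vdiff_left einner_vdiff_right einner_vscale_left einner_vscale_right

lemma enorm_vscale: "enorm d (vscale c x) = \<bar>c\<bar> * enorm d x"
  by (rule power2_eq_imp_eq, simp only: power_mult_distrib enorm_power2 einner_simps)
     (simp_all add: power2_eq_square)

lemma abs_einner_le: "\<bar>einner d x y\<bar> \<le> enorm d x * enorm d y"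
proof -
  have "\<bar>einner d x y\<bar> \<le> (\<Sum>i<d. \<bar>x i\<bar> * \<bar>y i\<bar>)"
    unfolding einner_def by (intro order.trans[OF sum_abs]) (simp add: abs_mult)
  also have "\<dots> \<le> enorm d x * enorm d y"
    unfolding enorm_def by (rule L2_set_mult_ineq)
  finally show ?thesis .
qed

lemma enorm_vdiff_commute: "enorm d (vdiff x y) = enorm d (vdiff y x)"
  by (simp add: enorm_def vdiff_def L2_set_def power2_commute)

lemma enorm_vdiff_triangle:
  "enorm d (vdiff x z) \<le> enorm d (vdiff x y) + enorm d (vdiff y z)"
  using L2_set_triangle_ineq[of "vdiff x y" "vdiff y z" "{..<d}"]
  by (simp add: enorm_def vdiff_def)

lemma enorm_le_vdiff: "enorm d x \<le> enorm d (vdiff x y) + enorm d y"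
  using enorm_vdiff_triangle[of d x "\<lambda>_. 0" y] by (simp add: vdiff_def)

lemma enorm_vdiff_self [simp]: "enorm d (vdiff x x) = 0"
  by (simp add: enorm_def vdiff_def L2_set_def)

lemma abs_le_enorm_vdiff:
  assumes "i < d"
  shows "\<bar>x i - y i\<bar> \<le> enorm d (vdiff x y)"
proof -
  have "L2_set (vdiff x y) {i} \<le> L2_set (vdiff x y) {..<d}"
    unfolding L2_set_def using assms by (intro real_sqrt_le_mono sum_mono2) auto
  then show ?thesis by (simp add: enorm_def vdiff_def)
qed

lemma enorm_vdiff_power2:
  "(enorm d (vdiff x y))\<^sup>2 = (enorm d x)\<^sup>2 - 2 * einner d x y + (enorm d y)\<^sup>2"
  by (simp add: enorm_power2 einner_simps einner_commute[of d y x])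

lemma continuous_on_enorm_vdiff: "continuous_on A (\<lambda>y. enorm d (vdiff y z))"
  unfolding enorm_def vdiff_def L2_set_def
  by (intro continuous_intros continuous_on_subset[OF continuous_on_product_coordinates]) auto

text \<open>The topology is the product topology, in which \<open>enorm d (vdiff x y)\<close> is
  continuous in \<open>x\<close> and vanishes at \<open>x = y\<close>. A Lipschitz bound in the
  explicit norm therefore gives continuity, and with it Borel measurability.\<close>

lemma continuous_on_enorm_lipschitz:
  fixes f :: "(nat \<Rightarrow> real) \<Rightarrow> real"
  assumes "\<And>x y. x \<in> A \<Longrightarrow> y \<in> A \<Longrightarrow> \<bar>f x - f y\<bar> \<le> L * enorm d (vdiff x y)"
  shows "continuous_on A f"
  unfolding continuous_on_def
proof
  fix y assume y: "y \<in> A"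
  have "((\<lambda>x. L * enorm d (vdiff x y)) \<longlongrightarrow> L * enorm d (vdiff y y)) (at y within A)"
    using continuous_on_enorm_vdiff[of A d y] y by (intro tendsto_intros) (auto simp: continuous_on_def)
  then have "((\<lambda>x. L * enorm d (vdiff x y)) \<longlongrightarrow> 0) (at y within A)" by simp
  then have "((\<lambda>x. f x - f y) \<longlongrightarrow> 0) (at y within A)"
    by (rule Lim_null_comparison[rotated]) (use assms y in \<open>auto simp: eventually_at_filter\<close>)
  then show "(f \<longlongrightarrow> f y) (at y within A)" by (simp add: LIM_zero_iff)
qed

section \<open>Projection onto a closed convex set\<close>

context
  fixes d :: nat and X :: "(nat \<Rightarrow> real) set"
  assumes closed: "closed X" and subset: "X \<subseteq> Rd d" and nonempty: "X \<noteq> {}"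
begin

text \<open>\<open>proj\<close> is a choice among minimizers, so existence comes first. A box around
  \<open>y\<close> is compact by Tychonoff; a minimizer over the part of \<open>X\<close> in the box
  is global, since points of \<open>X\<close> outside are farther from \<open>y\<close> than
  \<open>z0\<close>.\<close>

lemma is_arg_min_proj: "is_arg_min (\<lambda>z. enorm d (vdiff y z)) (\<lambda>z. z \<in> X) (proj d X y)"
proof -
  obtain z0 where z0: "z0 \<in> X" using nonempty by auto
  define r where "r = enorm d (vdiff y z0)"
  \<comment> \<open>Coordinates from \<open>d\<close> on are pinned to 0, as they are in all points
    of \<open>X\<close>; every factor of the infinite product is then compact.\<close>
  define box where "box = PiE UNIV (\<lambda>i. if i < d then {y i - r..y i + r} else {0})"
  have "compactin (powertop_real UNIV) box"
    unfolding box_def by (subst compactin_PiE) auto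
  then have "compact box"
    by (simp add: euclidean_product_topology)
  then have "compact (X \<inter> box)"
    using closed by (metis compact_Int_closed inf_commute)
  moreover have mem: "z \<in> box" if "z \<in> X" "enorm d (vdiff y z) \<le> r" for z
  proof -
    have "\<bar>y i - z i\<bar> \<le> r" if "i < d" for i
      using abs_le_enorm_vdiff[OF that, of y z] \<open>enorm d (vdiff y z) \<le> r\<close> by linarith
    moreover have "z i = 0" if "\<not> i < d" for i
      using subset \<open>z \<in> X\<close> that by (auto simp: topspace_Euclidean_space)
    ultimately show ?thesis by (simp add: box_def PiE_iff abs_le_iff algebra_simps)
  qed
  moreover have "z0 \<in> X \<inter> box" using mem[of z0] z0 by (simp add: r_def)
  ultimately obtain w where w: "w \<in> X \<inter> box"
    and min: "\<And>z. z \<in> X \<inter> box \<Longrightarrow> enorm d (vdiff w y) \<le> enorm d (vdiff z y)"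
    using continuous_attains_inf[of "X \<inter> box" "\<lambda>z. enorm d (vdiff z y)"]
    by (metis continuous_on_enorm_vdiff empty_iff)
  have "enorm d (vdiff y w) \<le> enorm d (vdiff y z)" if "z \<in> X" for z
  proof (cases "enorm d (vdiff y z) \<le> r")
    case True
    then show ?thesis using min[of z] mem[of z] that by (simp add: enorm_vdiff_commute)
  next
    case False
    then show ?thesis
      using min[of z0] \<open>z0 \<in> X \<inter> box\<close> by (simp add: enorm_vdiff_commute r_def)
  qed
  then have "is_arg_min (\<lambda>z. enorm d (vdiff y z)) (\<lambda>z. z \<in> X) w"
    using w by (auto simp: is_arg_min_def not_less)
  then show ?thesis
    unfolding proj_def arg_min_on_def arg_min_def
    using someI[of "is_arg_min (\<lambda>z. enorm d (vdiff y z)) (\<lambda>z. z \<in> X)" w] by simp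
qed

lemma proj_in: "proj d X y \<in> X"
  using is_arg_min_proj[of y] by (simp add: is_arg_min_def)

lemma proj_le: "z \<in> X \<Longrightarrow> enorm d (vdiff y (proj d X y)) \<le> enorm d (vdiff y z)"
  using is_arg_min_proj[of y] by (auto simp: is_arg_min_def not_less)

context
  assumes convex: "convex_set X"
begin

text \<open>Moving from the projection a fraction \<open>u\<close> of the way to \<open>z\<close>
  stays in \<open>X\<close>. If the inner product \<open>c\<close> were positive, the first-order
  term \<open>- 2 * u * c\<close> would bring the point strictly closer to \<open>y\<close> for
  small \<open>u\<close>.\<close>

lemma proj_obtuse:
  assumes z: "z \<in> X"
  shows "einner d (vdiff y (proj d X y)) (vdiff z (proj d X y)) \<le> 0"
proof (rule ccontr)
  define q a b where "q = proj d X y" and "a = vdiff y q" and "b = vdiff z q"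
  define c s where "c = einner d a b" and "s = (enorm d b)\<^sup>2"
  assume "\<not> ?thesis"
  then have c: "c > 0" by (simp add: c_def a_def b_def q_def)
  have s: "s \<ge> 0" by (simp add: s_def)
  \<comment> \<open>This size gives \<open>u * s \<le> c\<close>, against
    \<open>2 * c \<le> u * s\<close>, which minimality forces; the summand 1 covers
    \<open>s = 0\<close>.\<close>
  define u where "u = min 1 (c / (s + 1))"
  have u: "0 < u" "u \<le> 1" using c s by (auto simp: u_def)
  have "segment_point u q z \<in> X"
    using convex proj_in[of y] z u unfolding convex_set_def q_def by force
  then have "enorm d a \<le> enorm d (vdiff y (segment_point u q z))"
    using proj_le[of "segment_point u q z" y] by (simp add: a_def q_def)
  also have "vdiff y (segment_point u q z) = vdiff a (vscale u b)"
    by (auto simp: vdiff_def segment_point_def vscale_def a_def b_def algebra_simps)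
  finally have "(enorm d a)\<^sup>2 \<le> (enorm d (vdiff a (vscale u b)))\<^sup>2"
    by (simp add: power_mono)
  also have "\<dots> = (enorm d a)\<^sup>2 - 2 * u * c + u\<^sup>2 * s"
    by (simp add: enorm_vdiff_power2 einner_simps c_def s_def enorm_vscale power_mult_distrib)
  finally have "u * (2 * c) \<le> u * (u * s)" by (simp add: power2_eq_square)
  then have "2 * c \<le> u * s" using u by simp
  also have "\<dots> \<le> c / (s + 1) * s" using s by (intro mult_right_mono) (auto simp: u_def)
  also have "\<dots> \<le> c" using s c by (simp add: field_simps)
  finally show False using c by simp
qed

text \<open>Add the obtuse-angle inequalities at the two projections, each tested with the other
  one, and apply Cauchy-Schwarz.\<close>

lemma enorm_proj_proj_le:
  "enorm d (vdiff (proj d X y) (proj d X z)) \<le> enorm d (vdiff y z)"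
proof -
  define a b where "a = proj d X y" and "b = proj d X z"
  have "einner d (vdiff y a) (vdiff b a) \<le> 0" "einner d (vdiff z b) (vdiff a b) \<le> 0"
    unfolding a_def b_def by (intro proj_obtuse proj_in)+
  then have "(enorm d (vdiff a b))\<^sup>2 \<le> einner d (vdiff y z) (vdiff a b)"
    using einner_commute[of d b a] by (simp add: enorm_power2 einner_simps)
  also have "\<dots> \<le> enorm d (vdiff y z) * enorm d (vdiff a b)"
    using abs_einner_le abs_le_iff by blast
  finally show ?thesis
    by (cases "enorm d (vdiff a b) = 0")
       (auto simp: power2_eq_square a_def b_def less_le mult_le_cancel_right)
qed

text \<open>A point of \<open>X\<close> has distance 0 from its own projection, so nonexpansiveness
  applies with \<open>z\<close> in place of \<open>proj d X z\<close>.\<close>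

lemma enorm_proj_le:
  assumes "z \<in> X"
  shows "enorm d (vdiff (proj d X y) z) \<le> enorm d (vdiff y z)"
  using enorm_vdiff_triangle[of d "proj d X y" z "proj d X z"] enorm_proj_proj_le[of y z]
    proj_le[OF assms, of z] by (simp add: enorm_vdiff_commute[of d z])

text \<open>Coordinates below \<open>d\<close> are 1-Lipschitz in \<open>enorm d\<close>, the others
  constantly 0. The measurability of the iterates rests on this.\<close>

lemma continuous_on_proj: "continuous_on A (proj d X)"
proof (rule continuous_on_coordinatewise_then_product)
  fix i
  show "continuous_on A (\<lambda>y. proj d X y i)"
  proof (cases "i < d")
    case True
    have "\<bar>proj d X x i - proj d X y i\<bar> \<le> 1 * enorm d (vdiff x y)" for x y
      using abs_le_enorm_vdiff[OF True] enorm_proj_proj_le by (metis mult_1 order.trans)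
    then show ?thesis by (rule continuous_on_enorm_lipschitz)
  next
    case False
    then have "proj d X y i = 0" for y
      using proj_in[of y] subset by (auto simp: topspace_Euclidean_space)
    then show ?thesis by simp
  qed
qed

end

end

section \<open>Clipping\<close>

lemma enorm_clip_le:
  assumes "0 < K"
  shows "enorm d (clip d K v) \<le> K" "enorm d (clip d K v) \<le> enorm d v"
proof -
  have "enorm d (clip d K v) = min 1 (K / enorm d v) * enorm d v"
    using assms by (simp add: clip_def enorm_vscale)
  then show "enorm d (clip d K v) \<le> K" "enorm d (clip d K v) \<le> enorm d v"
    using assms by (cases "enorm d v = 0"; cases "enorm d v \<le> K"; force simp: less_le min_def field_simps)+
qed

lemma enorm_vdiff_clip:
  assumes "0 < K"
  shows "enorm d (vdiff v (clip d K v)) = max 0 (enorm d v - K)"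
proof -
  have "vdiff v (clip d K v) = vscale (1 - min 1 (K / enorm d v)) v"
    by (auto simp: clip_def vdiff_def vscale_def algebra_simps)
  then have "enorm d (vdiff v (clip d K v)) = (1 - min 1 (K / enorm d v)) * enorm d v"
    by (simp add: enorm_vscale)
  then show ?thesis
    using assms
    by (cases "enorm d v = 0"; cases "enorm d v \<le> K") (auto simp: less_le min_def max_def left_diff_distrib)
qed

lemma clip_bias:
  assumes "enorm d m \<le> G" "2 * G \<le> K" "0 < K" "1 < p" "p \<le> 2"
  shows "enorm d (vdiff v (clip d K v)) \<le> 2 * enorm d (vdiff v m) powr p * K powr (1 - p)"
proof (cases "enorm d v \<le> K")
  case True
  then show ?thesis using assms by (simp add: enorm_vdiff_clip)
next
  case False
  define u where "u = enorm d (vdiff v m)"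
  have u: "K / 2 \<le> u" "enorm d v - K \<le> u"
    using enorm_le_vdiff[of d v m] False assms by (auto simp: u_def)
  \<comment> \<open>Here \<open>2 * u / K\<close> is at least 1, so its power with exponent
    \<open>p - 1\<close> may be inserted; this trades a first power of the deviation for the
    \<open>p\<close>-th one, whose moment is controlled.\<close>
  have "u powr 1 * 1 \<le> u powr 1 * (2 * u / K) powr (p - 1)"
    using assms u by (intro mult_left_mono ge_one_powr_ge_zero) (auto simp: field_simps)
  also have "\<dots> = 2 powr (p - 1) * u powr p * K powr (1 - p)"
    using assms u by (simp add: powr_mult powr_divide powr_diff field_simps)
  also have "\<dots> \<le> 2 powr 1 * u powr p * K powr (1 - p)"
    using assms by (intro mult_right_mono powr_mono) auto
  finally show ?thesis
    using assms u False by (simp add: enorm_vdiff_clip u_def)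
qed

text \<open>If \<open>u \<le> K\<close>, the clipped norm is at most \<open>u + G\<close>, and one
  factor \<open>u powr (2 - p)\<close> of the square of \<open>u\<close> is raised to
  \<open>K powr (2 - p)\<close>. If \<open>u > K\<close>, the clipped norm is at most
  \<open>K\<close>, and the factor \<open>K powr p\<close> is raised to
  \<open>u powr p\<close>.\<close>

lemma clip_second_moment:
  assumes "enorm d m \<le> G" "0 < K" "1 < p" "p \<le> 2"
  shows "(enorm d (clip d K v))\<^sup>2 \<le> 2 * G\<^sup>2 + 2 * enorm d (vdiff v m) powr p * K powr (2 - p)"
proof -
  define u where "u = enorm d (vdiff v m)"
  show ?thesis
  proof (cases "u \<le> K")
    case True
    have "enorm d (clip d K v) \<le> u + G"
      using enorm_clip_le(2)[OF assms(2), of d v] enorm_le_vdiff[of d v m] assms by (simp add: u_def)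
    then have "(enorm d (clip d K v))\<^sup>2 \<le> (u + G)\<^sup>2" by (simp add: power_mono)
    also have "\<dots> \<le> 2 * G\<^sup>2 + 2 * u\<^sup>2"
      using zero_le_power2[of "u - G"] by (simp add: power2_eq_square algebra_simps)
    also have "u\<^sup>2 \<le> u powr p * K powr (2 - p)"
    proof (cases "u = 0")
      case False
      then have "0 < u" by (simp add: u_def less_le)
      then have "u\<^sup>2 = u powr p * u powr (2 - p)" by (simp flip: powr_add)
      also have "\<dots> \<le> u powr p * K powr (2 - p)"
        using True \<open>0 < u\<close> assms by (intro mult_left_mono powr_mono2) auto
      finally show ?thesis .
    qed simp
    finally show ?thesis by (simp add: u_def)
  next
    case False
    have "(enorm d (clip d K v))\<^sup>2 \<le> K\<^sup>2"
      using enorm_clip_le(1)[OF assms(2), of d v] by (simp add: power_mono)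
    also have "\<dots> = K powr p * K powr (2 - p)" using assms by (simp flip: powr_add)
    also have "\<dots> \<le> u powr p * K powr (2 - p)"
      using False assms by (intro mult_right_mono powr_mono2) auto
    also have "\<dots> \<le> 2 * G\<^sup>2 + 2 * (u powr p * K powr (2 - p))" by simp
    finally show ?thesis by (simp add: u_def)
  qed
qed

text \<open>After nonexpansiveness and expansion of the square, the clipped vector is split into
  \<open>v\<close> and the clipping error. Thus \<open>v\<close> enters linearly, ready for
  unbiasedness, and the error enters through a pointwise bound in the \<open>p\<close>-th power of
  the deviation.\<close>

lemma clipped_step_distance:
  assumes X: "closed X" "X \<subseteq> Rd d" "convex_set X" and z: "z \<in> X"
    and K: "enorm d m \<le> G" "2 * G \<le> K" "0 < K" "1 < p" "p \<le> 2" and \<eta>: "0 \<le> \<eta>"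
  shows "(enorm d (vdiff (proj d X (vdiff x (vscale \<eta> (clip d K v)))) z))\<^sup>2
    \<le> (enorm d (vdiff x z))\<^sup>2 - 2 * \<eta> * einner d v (vdiff x z)
      + (4 * \<eta> * K powr (1 - p) * enorm d (vdiff x z) + 2 * \<eta>\<^sup>2 * K powr (2 - p))
          * enorm d (vdiff v m) powr p
      + 2 * \<eta>\<^sup>2 * G\<^sup>2"
proof -
  define c w U where "c = clip d K v" and "w = vdiff x z" and "U = enorm d (vdiff v m) powr p"
  have "enorm d (vdiff (proj d X (vdiff x (vscale \<eta> c))) z) \<le> enorm d (vdiff (vdiff x (vscale \<eta> c)) z)"
    using X z by (intro enorm_proj_le) auto
  also have "vdiff (vdiff x (vscale \<eta> c)) z = vdiff w (vscale \<eta> c)"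
    by (auto simp: vdiff_def w_def)
  finally have "(enorm d (vdiff (proj d X (vdiff x (vscale \<eta> c))) z))\<^sup>2 \<le> (enorm d (vdiff w (vscale \<eta> c)))\<^sup>2"
    by (simp add: power_mono)
  also have "\<dots> = (enorm d w)\<^sup>2 - 2 * \<eta> * einner d v w + 2 * \<eta> * einner d (vdiff v c) w
      + \<eta>\<^sup>2 * (enorm d c)\<^sup>2"
    using \<eta> by (simp add: enorm_vdiff_power2 einner_simps enorm_vscale power_mult_distrib
        einner_commute[of d w] algebra_simps)
  also have "\<dots> \<le> (enorm d w)\<^sup>2 - 2 * \<eta> * einner d v w
      + 2 * \<eta> * (2 * U * K powr (1 - p) * enorm d w)
      + \<eta>\<^sup>2 * (2 * G\<^sup>2 + 2 * U * K powr (2 - p))"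
  proof -
    have "einner d (vdiff v c) w \<le> enorm d (vdiff v c) * enorm d w"
      using abs_einner_le abs_le_iff by blast
    also have "\<dots> \<le> 2 * U * K powr (1 - p) * enorm d w"
      using clip_bias[OF K] unfolding c_def U_def by (intro mult_right_mono) auto
    finally have "2 * \<eta> * einner d (vdiff v c) w \<le> 2 * \<eta> * (2 * U * K powr (1 - p) * enorm d w)"
      using \<eta> by (intro mult_left_mono) auto
    moreover have "\<eta>\<^sup>2 * (enorm d c)\<^sup>2 \<le> \<eta>\<^sup>2 * (2 * G\<^sup>2 + 2 * U * K powr (2 - p))"
      using clip_second_moment[OF K(1,3-5)] unfolding c_def U_def by (intro mult_left_mono) auto
    ultimately show ?thesis by linarith
  qed
  finally show ?thesis by (simp add: c_def w_def U_def algebra_simps)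
qed

section \<open>The recursion for the expected squared distances\<close>

text \<open>The difference of harmonic number and logarithm decreases from its value 1 at
  \<open>n = 1\<close>.\<close>

lemma harm_le_ln:
  assumes "n \<ge> 1"
  shows "harm n \<le> ln (exp 1 * real n)"
proof -
  obtain k where k: "n = Suc k" using assms by (cases n) auto
  have "harm (Suc k) - ln (real (Suc k)) \<le> harm (Suc 0) - ln (real (Suc 0))"
    by (rule decseqD[OF decseq_harm_diff_ln]) simp
  then show ?thesis by (simp add: k ln_mult harm_def)
qed

text \<open>With the roots replaced by their maximum \<open>S\<close> over \<open>n < T\<close>, the
  recursion telescopes and the weights sum to a harmonic number. Read at the maximizing index, the
  result bounds the square of \<open>S\<close> by an expression affine in \<open>S\<close>.\<close>

lemma recursion_sum_bound:
  fixes a b :: "nat \<Rightarrow> real" and \<alpha> r :: real and T :: nat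
  defines "L \<equiv> ln (exp 1 * real T)"
  assumes nonneg: "\<And>n. 0 \<le> a n" "\<And>n. 0 \<le> b n" "0 \<le> \<alpha>" "0 \<le> r" and T: "T \<ge> 1"
    and step: "\<And>n. n < T \<Longrightarrow>
      a (Suc n) + b n \<le> a n + (4 * \<alpha> * r * sqrt (a n) + 2 * \<alpha>\<^sup>2 * (1 + r)) / real (Suc n)"
  shows "(\<Sum>n<T. b n) \<le> 2 * a 0 + 18 * \<alpha>\<^sup>2 * (L + r\<^sup>2 * L\<^sup>2)"
proof -
  have "\<exists>N\<in>{..<T}. \<forall>n\<in>{..<T}. a n \<le> a N"
  proof -
    have "Max (a ` {..<T}) \<in> a ` {..<T}" using T by (intro Max_in) (auto simp: lessThan_empty_iff)
    then show ?thesis by (metis (no_types, lifting) Max_ge finite_imageI finite_lessThan image_iff)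
  qed
  then obtain N where N: "N < T" "\<And>n. n < T \<Longrightarrow> a n \<le> a N" by auto
  \<comment> \<open>\<open>S\<close> dominates every square root in the recursion, and \<open>S\<^sup>2 \<le> B\<close> closes the loop.\<close>
  define S where "S = sqrt (a N)"
  define B where "B = a 0 + (4 * \<alpha> * r * S + 2 * \<alpha>\<^sup>2 * (1 + r)) * L"
  have S: "0 \<le> S" "S\<^sup>2 = a N" by (simp_all add: S_def nonneg)
  have L: "1 \<le> L" using T by (simp add: L_def ln_mult)
  have telescope: "a m + (\<Sum>n<m. b n) \<le> a 0 + (4 * \<alpha> * r * S + 2 * \<alpha>\<^sup>2 * (1 + r)) * harm m"
    if "m \<le> T" for m
    using that
  proof (induction m)
    case 0
    then show ?case by (simp add: harm_def)
  next
    case (Suc m)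
    have "sqrt (a m) \<le> S" using N(2)[of m] Suc.prems by (simp add: S_def)
    then have "(4 * \<alpha> * r * sqrt (a m) + 2 * \<alpha>\<^sup>2 * (1 + r)) / real (Suc m)
        \<le> (4 * \<alpha> * r * S + 2 * \<alpha>\<^sup>2 * (1 + r)) / real (Suc m)"
      using nonneg by (intro divide_right_mono add_right_mono mult_left_mono) auto
    moreover have "(4 * \<alpha> * r * S + 2 * \<alpha>\<^sup>2 * (1 + r)) * harm (Suc m)
        = (4 * \<alpha> * r * S + 2 * \<alpha>\<^sup>2 * (1 + r)) * harm m
          + (4 * \<alpha> * r * S + 2 * \<alpha>\<^sup>2 * (1 + r)) / real (Suc m)"
      by (simp only: harm_Suc distrib_left divide_inverse)
    moreover have "(\<Sum>n<Suc m. b n) = (\<Sum>n<m. b n) + b m" by simp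
    ultimately show ?case
      using step[of m] Suc by linarith
  qed
  have bound: "a m + (\<Sum>n<m. b n) \<le> B" if "m \<le> T" for m
  proof -
    have "harm m \<le> L"
      using harm_mono[OF that, where ?'a = real] harm_le_ln[OF T] unfolding L_def by linarith
    then have "(4 * \<alpha> * r * S + 2 * \<alpha>\<^sup>2 * (1 + r)) * harm m
        \<le> (4 * \<alpha> * r * S + 2 * \<alpha>\<^sup>2 * (1 + r)) * L"
      using nonneg S by (intro mult_left_mono) auto
    then show ?thesis using telescope[OF that] unfolding B_def by linarith
  qed
  have "S\<^sup>2 \<le> B"
    using bound[of N] N(1) nonneg sum_nonneg[of "{..<N}" b] by (simp add: S(2))
  \<comment> \<open>Young's inequality, weighted so that \<open>S\<^sup>2 / 2 \<le> B / 2\<close>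
    can be absorbed into \<open>B\<close>.\<close>
  moreover have "4 * \<alpha> * r * S * L \<le> S\<^sup>2 / 2 + 8 * \<alpha>\<^sup>2 * r\<^sup>2 * L\<^sup>2"
    using zero_le_power2[of "S - 4 * \<alpha> * r * L"] by (simp add: power2_eq_square algebra_simps)
  moreover have "2 * \<alpha>\<^sup>2 * (1 + r) * L \<le> \<alpha>\<^sup>2 * (3 * L + r\<^sup>2 * L\<^sup>2)"
  proof -
    have "2 * (r * L) \<le> 1 + r\<^sup>2 * L\<^sup>2"
      using zero_le_power2[of "r * L - 1"] by (simp add: power2_eq_square algebra_simps)
    then have "2 * (1 + r) * L \<le> 3 * L + r\<^sup>2 * L\<^sup>2" using L by (simp add: algebra_simps)
    then have "\<alpha>\<^sup>2 * (2 * (1 + r) * L) \<le> \<alpha>\<^sup>2 * (3 * L + r\<^sup>2 * L\<^sup>2)"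
      by (intro mult_left_mono) auto
    then show ?thesis by (simp add: algebra_simps)
  qed
  moreover have "B = a 0 + 4 * \<alpha> * r * S * L + 2 * \<alpha>\<^sup>2 * (1 + r) * L"
    by (simp add: B_def algebra_simps)
  moreover have "\<alpha>\<^sup>2 * (3 * L + r\<^sup>2 * L\<^sup>2) = 3 * (\<alpha>\<^sup>2 * L) + \<alpha>\<^sup>2 * r\<^sup>2 * L\<^sup>2"
    by (simp add: algebra_simps)
  \<comment> \<open>Absorbing \<open>B / 2\<close> doubles all other terms:
    \<open>18 = 2 * (8 + 1)\<close> and \<open>6 = 2 * 3\<close>.\<close>
  ultimately have "B \<le> 2 * a 0 + 18 * (\<alpha>\<^sup>2 * r\<^sup>2 * L\<^sup>2) + 6 * (\<alpha>\<^sup>2 * L)" by linarith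
  also have "\<dots> \<le> 2 * a 0 + 18 * \<alpha>\<^sup>2 * (L + r\<^sup>2 * L\<^sup>2)"
    using L by (simp add: algebra_simps)
  finally show ?thesis using bound[of T] nonneg(1)[of T] by simp
qed

section \<open>One step of the method\<close>

context sgd_setting
begin

definition gap :: "(nat \<Rightarrow> real) \<Rightarrow> real" where
  "gap x = real_of_ereal (F x - F x_star)"

abbreviation dist_opt :: "(nat \<Rightarrow> real) \<Rightarrow> real" where
  "dist_opt x \<equiv> enorm d (vdiff x x_star)"

lemma X_closed': "closed X"
  using X_closed by (rule closedin_Euclidean_imp_closed)

lemma X_subset: "X \<subseteq> Rd d"
  using X_closed by (rule closedin_subset)

lemma x_star_in: "x_star \<in> X"
  using x_star_min by (simp add: is_arg_min_def)

lemma X_nonempty: "X \<noteq> {}"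
  using x_star_in by auto

lemma F_real:
  assumes "x \<in> X"
  shows "F x = ereal (real_of_ereal (F x))"
proof -
  have "x \<in> eff_dom d F"
    using assms X_interior interior_of_subset[of "Euclidean_space d" "eff_dom d F"] by (meson subsetD)
  then have "F x < \<infinity>" "x \<in> Rd d" by (simp_all add: eff_dom_def)
  moreover have "F x \<noteq> -\<infinity>" using F_convex \<open>x \<in> Rd d\<close> by (simp add: convex_fun_def)
  ultimately show ?thesis by (cases "F x") simp_all
qed

lemma gap_eq: "x \<in> X \<Longrightarrow> gap x = real_of_ereal (F x) - real_of_ereal (F x_star)"
  unfolding gap_def by (metis F_real x_star_in ereal_minus(1) real_of_ereal.simps(1))

lemma gap_nonneg:
  assumes "x \<in> X"
  shows "0 \<le> gap x"
proof -
  have "F x_star \<le> F x"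
    using x_star_min assms by (auto simp: is_arg_min_def not_less)
  then have "ereal (real_of_ereal (F x_star)) \<le> ereal (real_of_ereal (F x))"
    by (simp only: F_real[OF assms, symmetric] F_real[OF x_star_in, symmetric])
  then show ?thesis by (simp add: gap_eq assms)
qed

text \<open>Unbiasedness makes the oracle mean a subgradient at every point of \<open>X\<close>; it
  is the one used throughout.\<close>

lemma gap_subgradient:
  assumes "x \<in> X" "y \<in> X"
  shows "gap x + einner d (mean_vec (Q x)) (vdiff y x) \<le> gap y"
proof -
  have "F x + ereal (einner d (mean_vec (Q x)) (vdiff y x)) \<le> F y"
    using oracle_unbiased[OF assms(1)] assms(2) X_subset by (auto simp: subgradients_def)
  then have "ereal (real_of_ereal (F x)) + ereal (einner d (mean_vec (Q x)) (vdiff y x))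
      \<le> ereal (real_of_ereal (F y))"
    by (simp only: F_real[OF assms(1), symmetric] F_real[OF assms(2), symmetric])
  then show ?thesis by (simp add: gap_eq assms)
qed

text \<open>The subgradient inequality at either endpoint, with subgradients of norm at most
  \<open>G\<close>. Measurability and integrability of the gaps follow from it.\<close>

lemma gap_lipschitz:
  assumes "x \<in> X" "y \<in> X"
  shows "\<bar>gap x - gap y\<bar> \<le> G * enorm d (vdiff x y)"
proof -
  have *: "gap x - gap y \<le> G * enorm d (vdiff x y)" if "x \<in> X" "y \<in> X" for x y
  proof -
    have "\<bar>einner d (mean_vec (Q x)) (vdiff y x)\<bar> \<le> enorm d (mean_vec (Q x)) * enorm d (vdiff y x)"
      by (rule abs_einner_le)
    also have "\<dots> \<le> G * enorm d (vdiff x y)"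
      using subgradient_bound[OF that(1) oracle_unbiased[OF that(1)]]
      by (auto simp: enorm_vdiff_commute[of d y] intro: mult_right_mono)
    finally show ?thesis using gap_subgradient[OF that] by linarith
  qed
  from *[OF assms] *[OF assms(2,1)] show ?thesis
    by (simp add: enorm_vdiff_commute[of d y] abs_le_iff)
qed

lemma gap_le: "x \<in> X \<Longrightarrow> gap x \<le> G * dist_opt x"
  using gap_lipschitz[OF _ x_star_in] gap_eq[OF x_star_in] by fastforce

lemma gap_measurable [measurable]: "gap \<in> borel_measurable (restrict_space borel X)"
  by (intro borel_measurable_continuous_on_restrict continuous_on_enorm_lipschitz[of X gap G d] gap_lipschitz)

lemma gap_le_einner:
  assumes "x \<in> X"
  shows "gap x \<le> einner d (mean_vec (Q x)) (vdiff x x_star)"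
  using gap_subgradient[OF assms x_star_in] gap_eq[OF x_star_in] by (simp add: einner_simps)

lemma oracle_prob_space:
  assumes "x \<in> X"
  shows "prob_space (Q x)" "sets (Q x) = sets (Rd_borel d)"
  using measurable_space[OF oracle_kernel, of x] assms
  by (auto simp: space_restrict_space space_prob_algebra)

lemma oracle_measurable:
  assumes "x \<in> X" "f \<in> borel \<rightarrow>\<^sub>M N"
  shows "f \<in> Q x \<rightarrow>\<^sub>M N"
  using measurable_restrict_space1[OF assms(2), of "Rd d"]
  by (simp add: measurable_cong_sets[OF oracle_prob_space(2)[OF assms(1)] refl])

lemma oracle_deviation:
  assumes "x \<in> X"
  shows "integrable (Q x) (\<lambda>v. enorm d (vdiff v (mean_vec (Q x))) powr p)"
    and "(\<integral>v. enorm d (vdiff v (mean_vec (Q x))) powr p \<partial>Q x) \<le> \<sigma> powr p"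
proof -
  have meas: "(\<lambda>v. enorm d (vdiff v (mean_vec (Q x)))) \<in> borel \<rightarrow>\<^sub>M borel"
    by (intro borel_measurable_continuous_onI continuous_on_enorm_vdiff)
  then have "(\<lambda>v. enorm d (vdiff v (mean_vec (Q x))) powr p) \<in> borel_measurable (Q x)"
    by (intro oracle_measurable[OF assms]) measurable
  then show int: "integrable (Q x) (\<lambda>v. enorm d (vdiff v (mean_vec (Q x))) powr p)"
    using oracle_moment[OF assms] by (intro integrableI_bounded) (auto simp: le_less_trans)
  have "ennreal (\<integral>v. enorm d (vdiff v (mean_vec (Q x))) powr p \<partial>Q x) \<le> ennreal (\<sigma> powr p)"
    using oracle_moment[OF assms] by (subst nn_integral_eq_integral[OF int, symmetric]) auto
  then show "(\<integral>v. enorm d (vdiff v (mean_vec (Q x))) powr p \<partial>Q x) \<le> \<sigma> powr p"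
    by simp
qed

text \<open>Integrates the pointwise bound: the term linear in \<open>v\<close> turns into the inner
  product with the mean, which dominates the gap. The gap stands on the left to avoid subtraction in
  \<open>ennreal\<close>.\<close>

lemma expected_clipped_step:
  assumes x: "x \<in> X" and K: "2 * G \<le> K" and \<eta>: "0 \<le> \<eta>"
  shows "(\<integral>\<^sup>+v. ennreal ((dist_opt (proj d X (vdiff x (vscale \<eta> (clip d K v)))))\<^sup>2) \<partial>Q x)
      + ennreal (2 * \<eta> * gap x)
    \<le> ennreal ((dist_opt x)\<^sup>2
        + (4 * \<eta> * K powr (1 - p) * dist_opt x + 2 * \<eta>\<^sup>2 * K powr (2 - p)) * \<sigma> powr p
        + 2 * \<eta>\<^sup>2 * G\<^sup>2)"
proof -
  interpret N: prob_space "Q x" by (rule oracle_prob_space(1)[OF x])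
  define m w c where "m = mean_vec (Q x)" and "w = vdiff x x_star"
    and "c = 4 * \<eta> * K powr (1 - p) * dist_opt x + 2 * \<eta>\<^sup>2 * K powr (2 - p)"
  \<comment> \<open>\<open>B\<close> dominates a square and is thus nonnegative despite its signed
    linear term, so its Bochner integral equals its nonnegative one.\<close>
  define B where "B v = (dist_opt x)\<^sup>2 - 2 * \<eta> * einner d v w
    + c * enorm d (vdiff v m) powr p + 2 * \<eta>\<^sup>2 * G\<^sup>2" for v
  have c: "0 \<le> c" using \<eta> by (simp add: c_def)
  have "enorm d m \<le> G"
    using subgradient_bound[OF x oracle_unbiased[OF x]] by (simp add: m_def)
  then have le: "(dist_opt (proj d X (vdiff x (vscale \<eta> (clip d K v)))))\<^sup>2 \<le> B v" for v
    using clipped_step_distance[OF X_closed' X_subset X_convex x_star_in _ K _ p_range \<eta>, of m x v] G_pos K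
    by (simp add: B_def c_def w_def)
  then have B_nonneg: "0 \<le> B v" for v
    using order.trans zero_le_power2 by blast
  have int_inner: "integrable (Q x) (\<lambda>v. einner d v w)"
    unfolding einner_def using oracle_integrable[OF x] by (intro Bochner_Integration.integrable_sum integrable_mult_left) auto
  have inner: "(\<integral>v. einner d v w \<partial>Q x) = einner d m w"
    unfolding einner_def m_def mean_vec_def using oracle_integrable[OF x] by (subst Bochner_Integration.integral_sum) auto
  note int = int_inner oracle_deviation(1)[OF x, folded m_def]
  have intB: "integrable (Q x) B"
    unfolding B_def using int by auto
  have "(\<integral>v. B v \<partial>Q x) = (dist_opt x)\<^sup>2 - 2 * \<eta> * einner d m w
      + c * (\<integral>v. enorm d (vdiff v m) powr p \<partial>Q x) + 2 * \<eta>\<^sup>2 * G\<^sup>2"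
    unfolding B_def using int by (simp add: inner N.prob_space)
  also have "\<dots> \<le> (dist_opt x)\<^sup>2 - 2 * \<eta> * gap x + c * \<sigma> powr p + 2 * \<eta>\<^sup>2 * G\<^sup>2"
    using oracle_deviation(2)[OF x, folded m_def] gap_le_einner[OF x, folded m_def w_def] c \<eta>
    by (intro add_mono diff_mono mult_left_mono) auto
  finally have integral_B:
    "(\<integral>v. B v \<partial>Q x) + 2 * \<eta> * gap x \<le> (dist_opt x)\<^sup>2 + c * \<sigma> powr p + 2 * \<eta>\<^sup>2 * G\<^sup>2"
    by simp
  have "(\<integral>\<^sup>+v. ennreal ((dist_opt (proj d X (vdiff x (vscale \<eta> (clip d K v)))))\<^sup>2) \<partial>Q x)
      \<le> (\<integral>\<^sup>+v. ennreal (B v) \<partial>Q x)"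
    using le by (intro nn_integral_mono ennreal_leI) auto
  also have "\<dots> = ennreal (\<integral>v. B v \<partial>Q x)"
    using intB B_nonneg by (intro nn_integral_eq_integral) auto
  finally have "(\<integral>\<^sup>+v. ennreal ((dist_opt (proj d X (vdiff x (vscale \<eta> (clip d K v)))))\<^sup>2) \<partial>Q x)
      + ennreal (2 * \<eta> * gap x) \<le> ennreal (\<integral>v. B v \<partial>Q x) + ennreal (2 * \<eta> * gap x)"
    by (rule add_right_mono)
  also have "\<dots> = ennreal ((\<integral>v. B v \<partial>Q x) + 2 * \<eta> * gap x)"
    using B_nonneg gap_nonneg[OF x] \<eta> by (intro ennreal_plus[symmetric] integral_nonneg_AE) auto
  also have "\<dots> \<le> ennreal ((dist_opt x)\<^sup>2 + c * \<sigma> powr p + 2 * \<eta>\<^sup>2 * G\<^sup>2)"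
    using integral_B by (rule ennreal_leI)
  finally show ?thesis by (simp add: c_def)
qed

end

section \<open>The run and its law\<close>

lemma clip_measurable: "clip d K \<in> borel \<rightarrow>\<^sub>M borel"
proof (rule measurable_coordinatewise_then_product)
  fix i
  have [measurable]: "(\<lambda>v. enorm d v) \<in> borel_measurable borel"
    using borel_measurable_continuous_onI[OF continuous_on_enorm_vdiff[of UNIV d "\<lambda>_. 0"]]
    by (simp add: vdiff_def)
  show "(\<lambda>v. clip d K v i) \<in> borel_measurable borel"
    unfolding clip_def vscale_def by measurable
qed

text \<open>Adaptedness: the future may be cut off, or an answer appended at index \<open>n\<close>,
  without changing iterate \<open>n\<close>.\<close>

lemma sgd_iterate_cong:
  "(\<And>i. i < n \<Longrightarrow> \<xi> i = \<zeta> i) \<Longrightarrow> sgd_iterate d X K \<eta> x1 \<xi> n = sgd_iterate d X K \<eta> x1 \<zeta> n"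
  by (induction n) auto

text \<open>Isolates the features of the two schedules on which the analysis of a run rests. Since a
  clipped vector has norm at most \<open>K t\<close>, the last one limits every step to length
  \<open>\<alpha>\<close>.\<close>

locale sgd_run = sgd_setting +
  fixes K \<eta> :: "nat \<Rightarrow> real" and x1 :: "nat \<Rightarrow> real" and \<alpha> :: real
  assumes x1_in: "x1 \<in> X"
    and K_ge: "\<And>t. 2 * G \<le> K t"
    and \<eta>_nonneg: "\<And>t. 0 \<le> \<eta> t"
    and \<eta>_K_le: "\<And>t. \<eta> t * K t \<le> \<alpha>"
begin

abbreviation iter :: "(nat \<Rightarrow> nat \<Rightarrow> real) \<Rightarrow> nat \<Rightarrow> nat \<Rightarrow> real" where
  "iter \<equiv> sgd_iterate d X K \<eta> x1"

abbreviation update :: "nat \<Rightarrow> (nat \<Rightarrow> real) \<Rightarrow> (nat \<Rightarrow> real) \<Rightarrow> nat \<Rightarrow> real" where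
  "update t x v \<equiv> proj d X (vdiff x (vscale (\<eta> t) (clip d (K t) v)))"

abbreviation law :: "(nat \<Rightarrow> nat \<Rightarrow> real) measure" where
  "law \<equiv> sgd_law d X Q K \<eta> x1"

lemma K_pos: "0 < K t"
  using K_ge[of t] G_pos by linarith

lemma update_in: "update t x v \<in> X"
  using X_closed' X_subset X_nonempty by (rule proj_in)

lemma iter_in: "iter \<xi> n \<in> X"
  by (cases n) (simp_all add: x1_in update_in)

text \<open>\<open>J = {0..<n}\<close> serves the kernels that define the law,
  \<open>J = UNIV\<close> the random variables on the whole sample space.\<close>

lemma iter_measurable:
  assumes "{0..<n} \<subseteq> J"
  shows "(\<lambda>\<xi>. iter \<xi> n) \<in> PiM J (\<lambda>_. Rd_borel d) \<rightarrow>\<^sub>M restrict_space borel X"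
proof -
  have "(\<lambda>\<xi>. iter \<xi> n) \<in> borel_measurable (PiM J (\<lambda>_. Rd_borel d))"
    using assms
  proof (induction n)
    case (Suc n)
    have proj: "proj d X \<in> borel \<rightarrow>\<^sub>M borel"
      using X_closed' X_subset X_nonempty X_convex
      by (intro borel_measurable_continuous_onI continuous_on_proj)
    have "(\<lambda>\<xi>. \<xi> n) \<in> PiM J (\<lambda>_. Rd_borel d) \<rightarrow>\<^sub>M Rd_borel d"
      using Suc.prems by (intro measurable_component_singleton) auto
    then have "(\<lambda>\<xi>. \<xi> n) \<in> PiM J (\<lambda>_. Rd_borel d) \<rightarrow>\<^sub>M borel"
      by (simp add: measurable_restrict_space2_iff)
    then have "(\<lambda>\<xi>. clip d (K (Suc n)) (\<xi> n)) \<in> PiM J (\<lambda>_. Rd_borel d) \<rightarrow>\<^sub>M borel"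
      by (rule measurable_compose[OF _ clip_measurable])
    then have [measurable]: "(\<lambda>\<xi>. clip d (K (Suc n)) (\<xi> n) i) \<in> borel_measurable (PiM J (\<lambda>_. Rd_borel d))" for i
      by (rule measurable_product_then_coordinatewise)
    have "(\<lambda>\<xi>. iter \<xi> n) \<in> borel_measurable (PiM J (\<lambda>_. Rd_borel d))"
      using Suc.prems by (intro Suc.IH) auto
    then have [measurable]: "(\<lambda>\<xi>. iter \<xi> n i) \<in> borel_measurable (PiM J (\<lambda>_. Rd_borel d))" for i
      by (rule measurable_product_then_coordinatewise)
    have "(\<lambda>\<xi>. vdiff (iter \<xi> n) (vscale (\<eta> (Suc n)) (clip d (K (Suc n)) (\<xi> n))))
        \<in> borel_measurable (PiM J (\<lambda>_. Rd_borel d))"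
      unfolding vdiff_def vscale_def by (rule measurable_coordinatewise_then_product) measurable
    then show ?case
      by (simp add: measurable_compose[OF _ proj])
  qed simp
  then show ?thesis
    using iter_in by (intro measurable_restrict_space2) auto
qed

sublocale IT: Ionescu_Tulcea "\<lambda>n \<xi>. Q (iter \<xi> n)" "\<lambda>_. Rd_borel d"
proof (rule Ionescu_Tulcea.intro)
  fix n
  show "(\<lambda>\<xi>. Q (iter \<xi> n)) \<in> PiM {0..<n} (\<lambda>_. Rd_borel d) \<rightarrow>\<^sub>M subprob_algebra (Rd_borel d)"
    by (rule measurable_compose[OF iter_measurable measurable_prob_algebraD[OF oracle_kernel]]) simp
qed (rule oracle_prob_space(1)[OF iter_in])

section \<open>Finite marginals of the law and the tower property\<close>

lemma law_eq: "law = IT.PF.lim"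
  by (simp add: sgd_law_def)

lemma sets_law [measurable_cong]: "sets law = sets (PiM UNIV (\<lambda>_. Rd_borel d))"
  unfolding law_eq by simp

lemma undefined_in_space: "(\<lambda>_. undefined) \<in> space (PiM {0..<0::nat} (\<lambda>_. Rd_borel d))"
  by (auto simp: space_PiM PiE_iff extensional_def)

lemma distr_law:
  "distr law (PiM {0..<n} (\<lambda>_. Rd_borel d)) (\<lambda>\<xi>. restrict \<xi> {0..<n}) = IT.C 0 n (\<lambda>_. undefined)"
proof -
  \<comment> \<open>\<open>IT.up_to J\<close> is the length of the history from which the marginal
    on the index set \<open>J\<close> is cut.\<close>
  have "IT.up_to {0..<n} = n"
    by (rule antisym) (simp add: IT.up_to_iff, metis IT.up_to_iff finite_atLeastLessThan
        atLeastLessThan_iff le0 le_refl linorder_not_less order_less_irrefl)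
  then have "distr law (PiM {0..<n} (\<lambda>_. Rd_borel d)) (\<lambda>\<xi>. restrict \<xi> {0..<n})
    = distr (IT.C 0 n (\<lambda>_. undefined)) (PiM {0..<n} (\<lambda>_. Rd_borel d)) (\<lambda>\<xi>. restrict \<xi> {0..<n})"
    unfolding law_eq by (simp add: IT.distr_lim IT.CI_def)
  also have "\<dots> = IT.C 0 n (\<lambda>_. undefined)"
    using IT.distr_C[OF order_refl undefined_in_space, of n] by simp
  finally show ?thesis .
qed

lemma restrict_measurable_law:
  "(\<lambda>\<xi>. restrict \<xi> {0..<n}) \<in> law \<rightarrow>\<^sub>M PiM {0..<n} (\<lambda>_. Rd_borel d)"
  unfolding measurable_cong_sets[OF sets_law refl]
  by (rule measurable_restrict_subset) simp

text \<open>Image measures keep the total mass, so the marginal on the empty set of answers already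
  decides it.\<close>

lemma prob_space_law: "prob_space law"
proof (rule prob_space_distrD[OF restrict_measurable_law[of 0]])
  show "prob_space (distr law (PiM {0..<0::nat} (\<lambda>_. Rd_borel d)) (\<lambda>\<xi>. restrict \<xi> {0..<0}))"
    unfolding distr_law by (rule IT.prob_space_C[OF undefined_in_space])
qed

lemma iter_measurable_law: "(\<lambda>\<xi>. iter \<xi> n) \<in> law \<rightarrow>\<^sub>M restrict_space borel X"
  unfolding measurable_cong_sets[OF sets_law refl] by (rule iter_measurable) simp

text \<open>Iterate \<open>n\<close> is a function of the first \<open>n\<close> answers, so its
  expectation moves to the finite history, where the next answer can be integrated out.\<close>

lemma nn_integral_iter:
  assumes "h \<in> borel_measurable (restrict_space borel X)"
  shows "(\<integral>\<^sup>+\<xi>. h (iter \<xi> n) \<partial>law) = (\<integral>\<^sup>+\<omega>. h (iter \<omega> n) \<partial>IT.C 0 n (\<lambda>_. undefined))"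
proof -
  have "(\<lambda>\<omega>. h (iter \<omega> n)) \<in> borel_measurable (PiM {0..<n} (\<lambda>_. Rd_borel d))"
    by (rule measurable_compose[OF iter_measurable assms]) simp
  then have "(\<integral>\<^sup>+\<omega>. h (iter \<omega> n) \<partial>IT.C 0 n (\<lambda>_. undefined))
    = (\<integral>\<^sup>+\<xi>. h (iter (restrict \<xi> {0..<n}) n) \<partial>law)"
    by (simp add: distr_law[symmetric] nn_integral_distr[OF restrict_measurable_law])
  moreover have "iter (restrict \<xi> {0..<n}) n = iter \<xi> n" for \<xi>
    by (rule sgd_iterate_cong) simp
  ultimately show ?thesis by simp
qed

text \<open>
  The tower property, stated so that measurability of the inner integral in \<open>x\<close>, hence joint
  measurability of \<^term>\<open>update\<close>, is not required.
\<close>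

lemma nn_integral_iter_Suc_le:
  assumes h: "h \<in> borel_measurable (restrict_space borel X)"
    and k: "k \<in> borel_measurable (restrict_space borel X)"
    and R: "R \<in> borel_measurable (restrict_space borel X)"
    and le: "\<And>x. x \<in> X \<Longrightarrow> (\<integral>\<^sup>+v. h (update (Suc n) x v) \<partial>Q x) + k x \<le> R x"
  shows "(\<integral>\<^sup>+\<xi>. h (iter \<xi> (Suc n)) \<partial>law) + (\<integral>\<^sup>+\<xi>. k (iter \<xi> n) \<partial>law) \<le> (\<integral>\<^sup>+\<xi>. R (iter \<xi> n) \<partial>law)"
proof -
  define C where "C = IT.C 0 n (\<lambda>_. undefined)"
  define E where "E \<omega> = (\<integral>\<^sup>+\<zeta>. h (iter \<zeta> (Suc n)) \<partial>IT.eP n \<omega>)" for \<omega>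
  have sets_C: "sets C = sets (PiM {0..<n} (\<lambda>_. Rd_borel d))"
    and space_C: "space C = space (PiM {0..<n} (\<lambda>_. Rd_borel d))"
    using IT.sets_C[OF undefined_in_space, of n] IT.space_C[OF undefined_in_space, of n] by (simp_all add: C_def)
  have h_meas: "(\<lambda>\<zeta>. h (iter \<zeta> (Suc n))) \<in> borel_measurable (PiM {0..<Suc n} (\<lambda>_. Rd_borel d))"
    by (rule measurable_compose[OF iter_measurable h]) simp
  have k_meas: "(\<lambda>\<omega>. k (iter \<omega> n)) \<in> borel_measurable C"
    unfolding measurable_cong_sets[OF sets_C refl] by (rule measurable_compose[OF iter_measurable k]) simp
  have eP: "IT.eP n \<in> C \<rightarrow>\<^sub>M subprob_algebra (PiM {0..<Suc n} (\<lambda>_. Rd_borel d))"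
    unfolding measurable_cong_sets[OF sets_C refl] by (rule IT.measurable_eP)
  have E_meas: "E \<in> borel_measurable C"
    unfolding E_def by (rule measurable_compose[OF eP nn_integral_measurable_subprob_algebra[OF h_meas]])
  \<comment> \<open>\<open>IT.eP n\<close> appends an answer drawn from \<open>Q\<close> at iterate
    \<open>n\<close>, and by adaptedness that iterate stays put.\<close>
  have E: "E \<omega> = (\<integral>\<^sup>+v. h (update (Suc n) (iter \<omega> n) v) \<partial>Q (iter \<omega> n))" if "\<omega> \<in> space C" for \<omega>
  proof -
    have "iter (fun_upd \<omega> n v) n = iter \<omega> n" for v by (rule sgd_iterate_cong) simp
    then show ?thesis
      unfolding E_def using that by (subst IT.nn_integral_eP[OF _ h_meas]) (simp_all add: space_C)
  qed
  have "(\<integral>\<^sup>+\<xi>. h (iter \<xi> (Suc n)) \<partial>law) = (\<integral>\<^sup>+\<omega>. E \<omega> \<partial>C)"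
    unfolding nn_integral_iter[OF h] E_def using nn_integral_bind[OF h_meas eP] by (simp add: C_def)
  then have "(\<integral>\<^sup>+\<xi>. h (iter \<xi> (Suc n)) \<partial>law) + (\<integral>\<^sup>+\<xi>. k (iter \<xi> n) \<partial>law)
      = (\<integral>\<^sup>+\<omega>. E \<omega> + k (iter \<omega> n) \<partial>C)"
    using E_meas k_meas by (simp add: nn_integral_iter[OF k] C_def nn_integral_add)
  also have "\<dots> \<le> (\<integral>\<^sup>+\<omega>. R (iter \<omega> n) \<partial>C)"
    using le[OF iter_in] by (intro nn_integral_mono) (simp add: E)
  finally show ?thesis by (simp add: nn_integral_iter[OF R] C_def)
qed

section \<open>Integrability and the expected recursion along the run\<close>

lemma dist_opt_measurable [measurable]: "dist_opt \<in> borel_measurable (restrict_space borel X)"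
  by (intro borel_measurable_continuous_on_restrict continuous_on_enorm_vdiff)

lemma dist_opt_iter_le: "dist_opt (iter \<xi> n) \<le> dist_opt x1 + real n * \<alpha>"
proof (induction n)
  case (Suc n)
  define y where "y = vscale (\<eta> (Suc n)) (clip d (K (Suc n)) (\<xi> n))"
  have "enorm d y \<le> \<eta> (Suc n) * K (Suc n)"
    using enorm_clip_le(1)[OF K_pos] \<eta>_nonneg unfolding y_def enorm_vscale
    by (auto intro: mult_left_mono)
  then have "enorm d y \<le> \<alpha>" using \<eta>_K_le order.trans by blast
  have "dist_opt (iter \<xi> (Suc n)) \<le> dist_opt (vdiff (iter \<xi> n) y)"
    unfolding y_def using X_closed' X_subset X_nonempty X_convex x_star_in
    by (simp add: enorm_proj_le)
  also have "\<dots> \<le> enorm d (vdiff (vdiff (iter \<xi> n) y) (iter \<xi> n)) + dist_opt (iter \<xi> n)"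
    by (rule enorm_vdiff_triangle)
  also have "enorm d (vdiff (vdiff (iter \<xi> n) y) (iter \<xi> n)) = enorm d y"
    by (simp add: enorm_def vdiff_def L2_set_def)
  finally show ?case using Suc \<open>enorm d y \<le> \<alpha>\<close> by (simp add: algebra_simps)
qed simp

lemma integrable_dist_opt:
  "integrable law (\<lambda>\<xi>. dist_opt (iter \<xi> n))" "integrable law (\<lambda>\<xi>. (dist_opt (iter \<xi> n))\<^sup>2)"
proof -
  interpret prob_space law by (rule prob_space_law)
  have *: "\<bar>dist_opt (iter \<xi> n)\<bar> \<le> dist_opt x1 + real n * \<alpha>" for \<xi>
    using dist_opt_iter_le by simp
  have meas: "(\<lambda>\<xi>. dist_opt (iter \<xi> n)) \<in> borel_measurable law"
    by (rule measurable_compose[OF iter_measurable_law dist_opt_measurable])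
  then show "integrable law (\<lambda>\<xi>. dist_opt (iter \<xi> n))"
    using * by (intro integrable_const_bound[where B="dist_opt x1 + real n * \<alpha>"]) auto
  have "norm ((dist_opt (iter \<xi> n))\<^sup>2) \<le> (dist_opt x1 + real n * \<alpha>)\<^sup>2" for \<xi>
    using dist_opt_iter_le by (simp add: power_mono)
  then show "integrable law (\<lambda>\<xi>. (dist_opt (iter \<xi> n))\<^sup>2)"
    using meas by (intro integrable_const_bound[where B="(dist_opt x1 + real n * \<alpha>)\<^sup>2"]) auto
qed

lemma integrable_gap: "integrable law (\<lambda>\<xi>. gap (iter \<xi> n))"
proof (rule Bochner_Integration.integrable_bound)
  show "integrable law (\<lambda>\<xi>. G * dist_opt (iter \<xi> n))"
    using integrable_dist_opt by simp
  show "(\<lambda>\<xi>. gap (iter \<xi> n)) \<in> borel_measurable law"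
    by (rule measurable_compose[OF iter_measurable_law gap_measurable])
  show "AE \<xi> in law. norm (gap (iter \<xi> n)) \<le> norm (G * dist_opt (iter \<xi> n))"
    using gap_nonneg[OF iter_in] gap_le[OF iter_in] G_pos by (auto simp: abs_of_pos)
qed

text \<open>The tower property applied to the one-step bound. The parameter \<open>s\<close> bounds
  the scaled moment; for the schedule of the theorem it becomes
  \<open>r / real (Suc n)\<close>.\<close>

lemma expected_recursion:
  fixes s :: real
  assumes r: "\<sigma> powr p * K (Suc n) powr (- p) \<le> s" and \<alpha>G: "\<eta> (Suc n) * G \<le> \<alpha> / sqrt (real (Suc n))"
  shows "(\<integral>\<xi>. (dist_opt (iter \<xi> (Suc n)))\<^sup>2 \<partial>law) + 2 * \<eta> (Suc n) * (\<integral>\<xi>. gap (iter \<xi> n) \<partial>law)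
    \<le> (\<integral>\<xi>. (dist_opt (iter \<xi> n))\<^sup>2 \<partial>law)
      + 4 * \<alpha> * s * sqrt (\<integral>\<xi>. (dist_opt (iter \<xi> n))\<^sup>2 \<partial>law)
      + 2 * \<alpha>\<^sup>2 * s + 2 * \<alpha>\<^sup>2 / real (Suc n)"
proof -
  interpret prob_space law by (rule prob_space_law)
  define k e where "k = K (Suc n)" and "e = \<eta> (Suc n)"
  have k: "0 < k" "2 * G \<le> k" and e: "0 \<le> e" and ek: "e * k \<le> \<alpha>"
    using K_pos K_ge \<eta>_nonneg \<eta>_K_le by (simp_all add: k_def e_def)
  have \<alpha>: "0 \<le> \<alpha>" using order.trans[OF mult_nonneg_nonneg ek] e k by simp
  have s: "0 \<le> s" using order.trans[OF _ r] by simp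
  define R where "R x = (dist_opt x)\<^sup>2 + 4 * \<alpha> * s * dist_opt x + 2 * \<alpha>\<^sup>2 * s + 2 * \<alpha>\<^sup>2 / real (Suc n)" for x
  have R_nonneg: "0 \<le> R x" for x
    using \<alpha> s by (simp add: R_def)
  \<comment> \<open>With \<open>k powr (- p)\<close> split off, the remaining powers of step size
    and level combine into powers of \<open>e * k \<le> \<alpha>\<close>.\<close>
  have pk: "k powr (1 - p) = k * k powr (- p)" "k powr (2 - p) = k\<^sup>2 * k powr (- p)"
    using k by (simp_all add: powr_diff powr_minus divide_inverse)
  have one_step: "(\<integral>\<^sup>+v. ennreal ((dist_opt (update (Suc n) x v))\<^sup>2) \<partial>Q x) + ennreal (2 * e * gap x)
      \<le> ennreal (R x)" if x: "x \<in> X" for x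
  proof -
    have "(4 * e * k powr (1 - p) * dist_opt x + 2 * e\<^sup>2 * k powr (2 - p)) * \<sigma> powr p
        = (4 * (e * k) * dist_opt x + 2 * (e * k)\<^sup>2) * (\<sigma> powr p * k powr (- p))"
      by (simp add: pk algebra_simps power2_eq_square)
    also have "\<dots> \<le> (4 * \<alpha> * dist_opt x + 2 * \<alpha>\<^sup>2) * s"
      using ek r s \<alpha> e k by (intro mult_mono add_mono power_mono) (auto simp: k_def)
    finally have "(4 * e * k powr (1 - p) * dist_opt x + 2 * e\<^sup>2 * k powr (2 - p)) * \<sigma> powr p
      \<le> 4 * \<alpha> * s * dist_opt x + 2 * \<alpha>\<^sup>2 * s" by (simp add: algebra_simps)
    moreover have "e\<^sup>2 * G\<^sup>2 \<le> \<alpha>\<^sup>2 / real (Suc n)"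
      using power_mono[OF \<alpha>G, of 2] e G_pos by (simp add: e_def power_mult_distrib power_divide)
    ultimately have "(dist_opt x)\<^sup>2
        + (4 * e * k powr (1 - p) * dist_opt x + 2 * e\<^sup>2 * k powr (2 - p)) * \<sigma> powr p
        + 2 * e\<^sup>2 * G\<^sup>2 \<le> R x"
      by (simp add: R_def)
    then show ?thesis
      using expected_clipped_step[OF x k(2) e] order.trans ennreal_leI unfolding k_def e_def by blast
  qed
  have int_R: "integrable law (\<lambda>\<xi>. R (iter \<xi> n))"
    unfolding R_def using integrable_dist_opt[of n] by auto
  have [measurable]: "R \<in> borel_measurable (restrict_space borel X)"
    unfolding R_def by measurable
  have "(\<integral>\<^sup>+\<xi>. ennreal ((dist_opt (iter \<xi> (Suc n)))\<^sup>2) \<partial>law) + (\<integral>\<^sup>+\<xi>. ennreal (2 * e * gap (iter \<xi> n)) \<partial>law)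
      \<le> (\<integral>\<^sup>+\<xi>. ennreal (R (iter \<xi> n)) \<partial>law)"
    using one_step by (intro nn_integral_iter_Suc_le) measurable
  then have "ennreal (\<integral>\<xi>. (dist_opt (iter \<xi> (Suc n)))\<^sup>2 \<partial>law) + ennreal (\<integral>\<xi>. 2 * e * gap (iter \<xi> n) \<partial>law)
      \<le> ennreal (\<integral>\<xi>. R (iter \<xi> n) \<partial>law)"
    using integrable_dist_opt(2) integrable_gap int_R R_nonneg gap_nonneg[OF iter_in] e
    by (simp add: nn_integral_eq_integral del: sgd_iterate.simps)
  then have "(\<integral>\<xi>. (dist_opt (iter \<xi> (Suc n)))\<^sup>2 \<partial>law) + 2 * e * (\<integral>\<xi>. gap (iter \<xi> n) \<partial>law)
      \<le> (\<integral>\<xi>. R (iter \<xi> n) \<partial>law)"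
    using gap_nonneg[OF iter_in] e R_nonneg
    by (simp add: integral_nonneg_AE mult_nonneg_nonneg del: sgd_iterate.simps flip: ennreal_plus)
  also have "\<dots> = (\<integral>\<xi>. (dist_opt (iter \<xi> n))\<^sup>2 \<partial>law)
      + 4 * \<alpha> * s * (\<integral>\<xi>. dist_opt (iter \<xi> n) \<partial>law) + 2 * \<alpha>\<^sup>2 * s + 2 * \<alpha>\<^sup>2 / real (Suc n)"
    unfolding R_def using integrable_dist_opt[of n] by (simp add: prob_space)
  \<comment> \<open>Nonnegativity of the variance.\<close>
  also have "(\<integral>\<xi>. dist_opt (iter \<xi> n) \<partial>law) \<le> sqrt (\<integral>\<xi>. (dist_opt (iter \<xi> n))\<^sup>2 \<partial>law)"
    using variance_positive[of "\<lambda>\<xi>. dist_opt (iter \<xi> n)"] integrable_dist_opt[of n]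
    by (intro real_le_rsqrt) (simp add: variance_eq)
  finally show ?thesis using \<alpha> s by (simp add: e_def mult_left_mono)
qed

section \<open>Jensen's inequality for the averaged iterate\<close>

lemma sgd_average_in:
  assumes "T \<ge> 1"
  shows "sgd_average d X K \<eta> x1 T \<xi> \<in> X"
  using assms
proof (induction T rule: dec_induct)
  case base
  show ?case using x1_in by (simp add: sgd_average_def)
next
  case (step T)
  have *: "(s + x) / (1 + real T) = (1 - 1 / (1 + real T)) * (s / real T) + x / (1 + real T)" for x s
  proof -
    have "1 - 1 / (1 + real T) = real T / (1 + real T)"
      by (simp add: field_simps)
    then show ?thesis using step.hyps by (simp add: add_divide_distrib)
  qed
  \<comment> \<open>\<open>convex_set\<close> speaks of two points only, so the average is built up
    one iterate at a time, each new one with weight \<open>1 / real (Suc T)\<close>.\<close>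
  have "sgd_average d X K \<eta> x1 (Suc T) \<xi>
      = segment_point (1 / real (Suc T)) (sgd_average d X K \<eta> x1 T \<xi>) (iter \<xi> T)"
    by (intro ext) (simp add: sgd_average_def segment_point_def *)
  then show ?case
    using X_convex step.IH iter_in[of \<xi> T] by (simp add: convex_set_def)
qed

text \<open>Sum the subgradient inequality at the average over all iterates: the deviations from the
  average sum to 0, and so do the linear terms.\<close>

lemma gap_average_le:
  assumes "T \<ge> 1"
  shows "gap (sgd_average d X K \<eta> x1 T \<xi>) \<le> (\<Sum>n<T. gap (iter \<xi> n)) / real T"
proof -
  define y where "y = sgd_average d X K \<eta> x1 T \<xi>"
  define m where "m = mean_vec (Q y)"
  have y: "real T * y i = (\<Sum>n<T. iter \<xi> n i)" for i
    using assms sum.atLeast1_atMost_eq[of "\<lambda>t. iter \<xi> (t - 1) i" T]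
    by (simp add: y_def sgd_average_def)
  have "(\<Sum>n<T. einner d m (vdiff (iter \<xi> n) y)) = (\<Sum>i<d. m i * (\<Sum>n<T. iter \<xi> n i - y i))"
    unfolding einner_def vdiff_def by (subst sum.swap) (simp add: sum_distrib_left)
  also have "\<dots> = 0" by (simp add: sum_subtractf y)
  finally have zero: "(\<Sum>n<T. einner d m (vdiff (iter \<xi> n) y)) = 0" .
  have "(\<Sum>n<T. gap y + einner d m (vdiff (iter \<xi> n) y)) \<le> (\<Sum>n<T. gap (iter \<xi> n))"
    unfolding m_def y_def by (intro sum_mono gap_subgradient iter_in sgd_average_in assms)
  then have "real T * gap y \<le> (\<Sum>n<T. gap (iter \<xi> n))"
    by (simp add: sum.distrib zero)
  then show ?thesis
    using assms by (simp add: y_def field_simps)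
qed

lemma expected_gap_average:
  assumes "T \<ge> 1"
  shows "integrable law (\<lambda>\<xi>. gap (sgd_average d X K \<eta> x1 T \<xi>))"
    and "(\<integral>\<xi>. gap (sgd_average d X K \<eta> x1 T \<xi>) \<partial>law) \<le> (\<Sum>n<T. \<integral>\<xi>. gap (iter \<xi> n) \<partial>law) / real T"
proof -
  define M where "M = (\<lambda>\<xi>. (\<Sum>n<T. gap (iter \<xi> n)) / real T)"
  have int_M: "integrable law M"
    unfolding M_def using integrable_gap by simp
  have iter_coord: "(\<lambda>\<xi>. iter \<xi> n i) \<in> borel_measurable law" for n i
  proof (rule measurable_product_then_coordinatewise)
    show "(\<lambda>\<xi>. iter \<xi> n) \<in> borel_measurable law"
      using iter_measurable_law[of n] by (simp add: measurable_restrict_space2_iff)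
  qed
  have "sgd_average d X K \<eta> x1 T \<in> borel_measurable law"
    unfolding sgd_average_def
    by (intro measurable_coordinatewise_then_product borel_measurable_divide borel_measurable_sum
        borel_measurable_const iter_coord)
  then have "sgd_average d X K \<eta> x1 T \<in> law \<rightarrow>\<^sub>M restrict_space borel X"
    using sgd_average_in[OF assms] by (intro measurable_restrict_space2) auto
  then have meas: "(\<lambda>\<xi>. gap (sgd_average d X K \<eta> x1 T \<xi>)) \<in> borel_measurable law"
    by (rule measurable_compose[OF _ gap_measurable])
  have le: "gap (sgd_average d X K \<eta> x1 T \<xi>) \<le> M \<xi>" for \<xi>
    unfolding M_def by (rule gap_average_le[OF assms])
  show int: "integrable law (\<lambda>\<xi>. gap (sgd_average d X K \<eta> x1 T \<xi>))"
    using int_M meas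
  proof (rule Bochner_Integration.integrable_bound)
    show "AE \<xi> in law. norm (gap (sgd_average d X K \<eta> x1 T \<xi>)) \<le> norm (M \<xi>)"
      using order.trans[OF le abs_ge_self] gap_nonneg[OF sgd_average_in[OF assms]] by (intro AE_I2) simp
  qed
  have "(\<integral>\<xi>. gap (sgd_average d X K \<eta> x1 T \<xi>) \<partial>law) \<le> (\<integral>\<xi>. M \<xi> \<partial>law)"
    using int int_M le by (intro integral_mono) auto
  also have "\<dots> = (\<Sum>n<T. \<integral>\<xi>. gap (iter \<xi> n) \<partial>law) / real T"
    unfolding M_def using integrable_gap by simp
  finally show "(\<integral>\<xi>. gap (sgd_average d X K \<eta> x1 T \<xi>) \<partial>law) \<le> (\<Sum>n<T. \<integral>\<xi>. gap (iter \<xi> n) \<partial>law) / real T" .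
qed

end

section \<open>The step sizes of the theorem\<close>

context sgd_setting
begin

lemma clip_level_pos: "0 < clip_level G p M t"
  using G_pos by (simp add: clip_level_def less_max_iff_disj)

text \<open>The conditions range over all \<open>t\<close>; at \<open>t = 0\<close> division by zero
  makes the step size 0. The run itself uses times from 1 on.\<close>

lemma sgd_run_clip_level:
  assumes "x1 \<in> X" "0 < \<alpha>"
  shows "sgd_run d F X x_star G p \<sigma> Q (clip_level G p M) (step_size G p M \<alpha>) x1 \<alpha>"
proof
  fix t
  have "step_size G p M \<alpha> t \<le> \<alpha> / clip_level G p M t"
    by (simp add: step_size_def)
  then show "step_size G p M \<alpha> t * clip_level G p M t \<le> \<alpha>"
    using clip_level_pos[of M t] by (simp add: pos_le_divide_eq)
  show "0 \<le> step_size G p M \<alpha> t"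
    using assms G_pos clip_level_pos[of M t] by (simp add: step_size_def)
qed (simp_all add: assms clip_level_def)

text \<open>The level is at least \<open>M * real t powr (1 / p)\<close>, whose power
  \<open>- p\<close> yields the harmonic weight \<open>1 / t\<close>. If \<open>M = 0\<close> then
  \<open>\<sigma> = 0\<close>, and both sides are 0.\<close>

lemma moment_clip_level_le:
  assumes "0 \<le> M" "M = 0 \<Longrightarrow> \<sigma> = 0" "t \<ge> 1"
  shows "\<sigma> powr p * clip_level G p M t powr (- p) \<le> (\<sigma> / M) powr p / real t"
proof (cases "\<sigma> = 0")
  case False
  then have M: "0 < M" using assms by fastforce
  have "clip_level G p M t powr (- p) \<le> (M * real t powr (1 / p)) powr (- p)"
    using M assms p_range by (intro powr_mono2') (auto simp: clip_level_def)
  also have "\<dots> = M powr (- p) / real t"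
    using M assms p_range by (simp add: powr_mult powr_powr powr_minus divide_inverse)
  finally have "\<sigma> powr p * clip_level G p M t powr (- p) \<le> \<sigma> powr p * (M powr (- p) / real t)"
    by (intro mult_left_mono) auto
  then show ?thesis
    using M \<sigma>_nonneg by (simp add: powr_divide powr_minus divide_inverse powr_mult inverse_powr mult.assoc)
qed (use p_range in simp)

lemma step_size_antimono:
  assumes "0 \<le> M" "0 < \<alpha>" "1 \<le> s" "s \<le> t"
  shows "step_size G p M \<alpha> t \<le> step_size G p M \<alpha> s"
proof -
  have "clip_level G p M s \<le> clip_level G p M t"
    unfolding clip_level_def using assms p_range by (intro max.mono mult_left_mono powr_mono2) auto
  then show ?thesis
    unfolding step_size_def using assms G_pos clip_level_pos[of M s]
    by (intro min.mono divide_left_mono mult_left_mono) auto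
qed

text \<open>\<open>real T * m\<close> is the maximum of \<open>G * sqrt (real T)\<close> and
  \<open>M * real T powr (1 / p)\<close>. The factor 2 accommodates the level \<open>2 * G\<close>,
  as \<open>sqrt (real T) \<ge> 1\<close>.\<close>

lemma step_size_ge:
  assumes "0 \<le> M" "0 < \<alpha>" "T \<ge> 1"
  defines "m \<equiv> max (G / sqrt (real T)) (M / real T powr ((p - 1) / p))"
  shows "\<alpha> / (2 * real T * m) \<le> step_size G p M \<alpha> T"
proof -
  have T: "1 \<le> sqrt (real T)" "sqrt (real T) * sqrt (real T) = real T" using assms by simp_all
  have m: "0 < m" using G_pos assms by (simp add: m_def less_max_iff_disj)
  have "G * sqrt (real T) = real T * (G / sqrt (real T))"
    using T by (simp add: real_div_sqrt field_simps)
  also have "\<dots> \<le> real T * m" by (intro mult_left_mono) (auto simp: m_def)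
  finally have G: "G * sqrt (real T) \<le> real T * m" .
  have "real T powr (1 / p) = real T / real T powr ((p - 1) / p)"
  proof -
    have "1 / p = 1 - (p - 1) / p" using p_range by (simp add: field_simps)
    then show ?thesis using assms by (metis powr_diff powr_one of_nat_0_le_iff)
  qed
  then have "M * real T powr (1 / p) = real T * (M / real T powr ((p - 1) / p))" by simp
  also have "\<dots> \<le> real T * m" by (intro mult_left_mono) (auto simp: m_def)
  finally have M: "M * real T powr (1 / p) \<le> real T * m" .
  have "G \<le> G * sqrt (real T)" using T G_pos by simp
  moreover have "real T * m \<le> 2 * real T * m" using m by simp
  ultimately have "clip_level G p M T \<le> 2 * real T * m" "G * sqrt (real T) \<le> 2 * real T * m"
    using G M unfolding clip_level_def by linarith+
  then show ?thesis
    unfolding step_size_def using assms G_pos T m clip_level_pos[of M T]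
    by (auto intro!: divide_left_mono mult_pos_pos)
qed

lemma expected_gap_clipped_sgd:
  assumes x1: "x1 \<in> X" and \<alpha>: "0 < \<alpha>" and T: "T \<ge> 1" and M: "0 \<le> M" "M = 0 \<Longrightarrow> \<sigma> = 0"
  defines "L \<equiv> ln (exp 1 * real T)"
    and "m \<equiv> max (G / sqrt (real T)) (M / real T powr ((p - 1) / p))"
  shows "expected_gap_le d F X x_star Q (clip_level G p M) (step_size G p M \<alpha>) x1 T
    (18 * (\<alpha> * (L + (\<sigma> / M) powr (2 * p) * L\<^sup>2) + (enorm d (vdiff x1 x_star))\<^sup>2 / \<alpha>) * m)"
proof -
  interpret sgd_run d F X x_star G p \<sigma> Q "clip_level G p M" "step_size G p M \<alpha>" x1 \<alpha>
    by (rule sgd_run_clip_level[OF x1 \<alpha>])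
  interpret prob_space law by (rule prob_space_law)
  define r \<eta> where "r = (\<sigma> / M) powr p" and "\<eta> = step_size G p M \<alpha>"
  define a where "a n = (\<integral>\<xi>. (dist_opt (iter \<xi> n))\<^sup>2 \<partial>law)" for n
  define e where "e n = (\<integral>\<xi>. gap (iter \<xi> n) \<partial>law)" for n
  define W where "W = L + r\<^sup>2 * L\<^sup>2"
  have L: "1 \<le> L" using T by (simp add: L_def ln_mult)
  have m: "0 < m" using G_pos T by (simp add: m_def less_max_iff_disj)
  have e: "0 \<le> e n" for n
    unfolding e_def by (intro integral_nonneg_AE AE_I2 gap_nonneg iter_in)
  have "(\<Sum>n<T. 2 * \<eta> (Suc n) * e n) \<le> 2 * a 0 + 18 * \<alpha>\<^sup>2 * (ln (exp 1 * real T) + r\<^sup>2 * (ln (exp 1 * real T))\<^sup>2)"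
  proof (rule recursion_sum_bound)
    show "a (Suc n) + 2 * \<eta> (Suc n) * e n
        \<le> a n + (4 * \<alpha> * r * sqrt (a n) + 2 * \<alpha>\<^sup>2 * (1 + r)) / real (Suc n)" for n
    proof -
      have "\<eta> (Suc n) \<le> \<alpha> / (G * sqrt (real (Suc n)))"
        unfolding \<eta>_def step_size_def by (rule min.cobounded1)
      then have "\<eta> (Suc n) * G \<le> \<alpha> / sqrt (real (Suc n))"
        using G_pos mult_right_mono[of "\<eta> (Suc n)" "\<alpha> / (G * sqrt (real (Suc n)))" G] by simp
      then have "a (Suc n) + 2 * \<eta> (Suc n) * e n
        \<le> a n + 4 * \<alpha> * (r / real (Suc n)) * sqrt (a n) + 2 * \<alpha>\<^sup>2 * (r / real (Suc n)) + 2 * \<alpha>\<^sup>2 / real (Suc n)"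
        unfolding \<eta>_def a_def e_def r_def
        by (intro expected_recursion moment_clip_level_le M) auto
      then show ?thesis by (simp add: add_divide_distrib algebra_simps)
    qed
    show "0 \<le> 2 * \<eta> (Suc n) * e n" for n
      using \<eta>_nonneg e by (simp add: \<eta>_def)
  qed (use \<alpha> T in \<open>simp_all add: a_def r_def\<close>)
  moreover have "a 0 = (dist_opt x1)\<^sup>2" by (simp add: a_def prob_space)
  ultimately have "(\<Sum>n<T. 2 * \<eta> (Suc n) * e n) \<le> 2 * (dist_opt x1)\<^sup>2 + 18 * \<alpha>\<^sup>2 * W"
    by (simp add: W_def L_def)
  \<comment> \<open>The last step size is the smallest, and its lower bound can replace all weights
    because the expected gaps are nonnegative.\<close>
  moreover have "2 * (\<alpha> / (2 * real T * m)) * (\<Sum>n<T. e n) \<le> (\<Sum>n<T. 2 * \<eta> (Suc n) * e n)"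
    unfolding sum_distrib_left
  proof (rule sum_mono)
    fix n assume "n \<in> {..<T}"
    then have "\<alpha> / (2 * real T * m) \<le> \<eta> (Suc n)"
      using step_size_ge[OF M(1) \<alpha> T] step_size_antimono[OF M(1) \<alpha>, of "Suc n" T]
      unfolding m_def \<eta>_def by (simp add: order.trans)
    then show "2 * (\<alpha> / (2 * real T * m)) * e n \<le> 2 * \<eta> (Suc n) * e n"
      using e by (intro mult_right_mono mult_left_mono) auto
  qed
  ultimately have "2 * (\<alpha> / (2 * real T * m)) * (\<Sum>n<T. e n) \<le> 2 * (dist_opt x1)\<^sup>2 + 18 * \<alpha>\<^sup>2 * W"
    by linarith
  then have "\<alpha> * ((\<Sum>n<T. e n) / real T) \<le> (2 * (dist_opt x1)\<^sup>2 + 18 * \<alpha>\<^sup>2 * W) * m"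
    using T m by (simp add: field_simps)
  \<comment> \<open>Raising 2 to 18 gives both terms a common constant.\<close>
  also have "\<dots> \<le> (18 * (dist_opt x1)\<^sup>2 + 18 * \<alpha>\<^sup>2 * W) * m"
    using m by (intro mult_right_mono) auto
  also have "\<dots> = \<alpha> * (18 * (\<alpha> * W + (dist_opt x1)\<^sup>2 / \<alpha>) * m)"
    using \<alpha> by (simp add: field_simps power2_eq_square)
  finally have "(\<Sum>n<T. e n) / real T \<le> 18 * (\<alpha> * W + (dist_opt x1)\<^sup>2 / \<alpha>) * m"
    using \<alpha> by (rule mult_left_le_imp_le)
  then have "(\<integral>\<xi>. gap (sgd_average d X (clip_level G p M) (step_size G p M \<alpha>) x1 T \<xi>) \<partial>law)
      \<le> 18 * (\<alpha> * W + (dist_opt x1)\<^sup>2 / \<alpha>) * m"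
    using expected_gap_average(2)[OF T] unfolding e_def by (rule order.trans[rotated])
  moreover have "r\<^sup>2 = (\<sigma> / M) powr (2 * p)"
    by (simp add: r_def power2_eq_square flip: powr_add)
  ultimately show ?thesis
    using expected_gap_average(1)[OF T]
    unfolding expected_gap_le_def Let_def gap_def W_def by simp
qed

end

theorem theorem4:
  shows "\<exists>C>0. \<forall>(d::nat) F X x_star G p \<sigma> Q x1 (\<alpha>::real) (T::nat).
    sgd_setting d F X x_star G p \<sigma> Q \<and> x1 \<in> X \<and> \<alpha> > 0 \<and> T \<ge> 1 \<longrightarrow>
      (\<forall>M\<ge>0. (M = 0 \<longrightarrow> \<sigma> = 0) \<longrightarrow>
        expected_gap_le d F X x_star Q (clip_level G p M) (step_size G p M \<alpha>) x1 T
          (C * (\<alpha> * (ln (exp 1 * real T) + (\<sigma> / M) powr (2 * p) * (ln (exp 1 * real T))\<^sup>2)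
                + (enorm d (vdiff x1 x_star))\<^sup>2 / \<alpha>)
             * max (G / sqrt (real T)) (M / real T powr ((p - 1) / p)))) \<and>
      expected_gap_le d F X x_star Q (clip_level G p \<sigma>) (step_size G p \<sigma> \<alpha>) x1 T
        (C * (\<alpha> * (ln (exp 1 * real T))\<^sup>2 + (enorm d (vdiff x1 x_star))\<^sup>2 / \<alpha>)
           * max (G / sqrt (real T)) (\<sigma> / real T powr ((p - 1) / p)))"
\<comment> \<open>The general bound holds with 18; the choice \<open>M = \<sigma>\<close> costs
  another factor 2, from \<open>L + L\<^sup>2 \<le> 2 * L\<^sup>2\<close>.\<close>
proof (intro exI[of _ 36] conjI allI impI; (elim conjE)?)
  fix d F X x_star G p \<sigma> Q x1 and \<alpha> :: real and T :: nat
  assume setting: "sgd_setting d F X x_star G p \<sigma> Q" and x1: "x1 \<in> X" and \<alpha>: "0 < \<alpha>" and T: "1 \<le> T"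
  interpret sgd_setting d F X x_star G p \<sigma> Q by (rule setting)
  define L D where "L = ln (exp 1 * real T)" and "D = (enorm d (vdiff x1 x_star))\<^sup>2 / \<alpha>"
  have L: "1 \<le> L" using T by (simp add: L_def ln_mult)
  have D: "0 \<le> D" using \<alpha> by (simp add: D_def)
  have m: "0 \<le> max (G / sqrt (real T)) y" for y
    using G_pos by (simp add: le_max_iff_disj)
  note bound = expected_gap_clipped_sgd[OF x1 \<alpha> T, folded L_def D_def]
  have weaken: "expected_gap_le d F X x_star Q K \<eta> x1 T B'"
    if "expected_gap_le d F X x_star Q K \<eta> x1 T B" "B \<le> B'" for K \<eta> B B'
    using that by (auto simp: expected_gap_le_def Let_def)
  show "expected_gap_le d F X x_star Q (clip_level G p M) (step_size G p M \<alpha>) x1 T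
      (36 * (\<alpha> * (ln (exp 1 * real T) + (\<sigma> / M) powr (2 * p) * (ln (exp 1 * real T))\<^sup>2)
        + (enorm d (vdiff x1 x_star))\<^sup>2 / \<alpha>) * max (G / sqrt (real T)) (M / real T powr ((p - 1) / p)))"
    if "0 \<le> M" "M = 0 \<longrightarrow> \<sigma> = 0" for M
    unfolding L_def[symmetric] D_def[symmetric]
    using that L D m \<alpha> by (intro weaken[OF bound] mult_right_mono) auto
  \<comment> \<open>The quotient is 1 for \<open>\<sigma> > 0\<close> and \<open>0 / 0 = 0\<close>
    otherwise, in agreement with the convention.\<close>
  have "(\<sigma> / \<sigma>) powr (2 * p) \<le> 1" by (cases "\<sigma> = 0") simp_all
  then have "(\<sigma> / \<sigma>) powr (2 * p) * L\<^sup>2 \<le> 1 * L\<^sup>2" by (intro mult_right_mono) auto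
  moreover have "L \<le> L\<^sup>2" using L by (simp add: self_le_power)
  ultimately have "\<alpha> * (L + (\<sigma> / \<sigma>) powr (2 * p) * L\<^sup>2) \<le> \<alpha> * (2 * L\<^sup>2)"
    using \<alpha> by (intro mult_left_mono) auto
  then have "18 * (\<alpha> * (L + (\<sigma> / \<sigma>) powr (2 * p) * L\<^sup>2) + D) \<le> 36 * (\<alpha> * L\<^sup>2 + D)"
    using D by (simp add: algebra_simps)
  then show "expected_gap_le d F X x_star Q (clip_level G p \<sigma>) (step_size G p \<sigma> \<alpha>) x1 T
      (36 * (\<alpha> * (ln (exp 1 * real T))\<^sup>2 + (enorm d (vdiff x1 x_star))\<^sup>2 / \<alpha>)
        * max (G / sqrt (real T)) (\<sigma> / real T powr ((p - 1) / p)))"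
    unfolding L_def[symmetric] D_def[symmetric]
    using \<sigma>_nonneg m by (intro weaken[OF bound] mult_right_mono) auto
qed simp

end
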